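(* For any integral lattice $\mathcal{L} \subset \mathbb{R}^n$ and any positive integer $k$, \[ N_{\leq k}(\mathcal{L}) \leq 2\binom{n+2k-1}{2k-1} - 1 . \] In fact, \[ N_{=k}(\mathcal{L}) \leq 2\binom{n+2k-2}{2k-1} . \] Moreover, for any constant positive integer $k$, \[ N_{\leq k}(\mathcal{L}) \leq 2^k (k-1)!\, n^k + o(n^k), \] that is, for every positive integer $k$ there is a function $f_k(n)$, depending only on $k$ and $n$, with $\lim_{n\to\infty} f_k(n)/n^k = 0$, such that for every positive integer $n$ and every integral lattice $\mathcal{L} \subset \mathbb{R}^n$, $N_{\leq k}(\mathcal{L}) \leq 2^k (k-1)!\, n^k + f_k(n)$.
   Context: A lattice $\mathcal{L} \subset \mathbb{R}^n$ is the set of integer linear combinations of some linearly independent vectors in $\mathbb{R}^n$. It is called integral if $\langle \boldsymbol{y}_1, \boldsymbol{y}_2\rangle \in \mathbb{Z}$ for all $\boldsymbol{y}_1, \boldsymbol{y}_2 \in \mathcal{L}$, where $\langle\cdot,\cdot\rangle$ is the standard inner product. With $\|\cdot\|$ the Euclidean norm, define $N_{\leq k}(\mathcal{L}) := |\{\boldsymbol{y} \in \mathcal{L} : \|\boldsymbol{y}\|^2 \leq k\}|$ and $N_{=k}(\mathcal{L}) := |\{\boldsymbol{y} \in \mathcal{L} : \|\boldsymbol{y}\|^2 = k\}|$. Here $n$ is a positive integer. *)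

theory Defs
  imports Complex_Main "Jordan_Normal_Form.VS_Connect"
begin

text \<open>The theorem quantifies over the dimension \<open>n\<close> inside the formula, so the space of real
  \<open>n\<close>-tuples is the carrier \<open>carrier_vec n\<close> rather than a type indexed by its dimension.\<close>

abbreviation real_lincomb :: "nat \<Rightarrow> (real vec \<Rightarrow> real) \<Rightarrow> real vec set \<Rightarrow> real vec" where
  "real_lincomb n \<equiv> module.lincomb (module_vec TYPE(real) n)"

abbreviation real_lin_indpt :: "nat \<Rightarrow> real vec set \<Rightarrow> bool" where
  "real_lin_indpt n B \<equiv> \<not> module.lin_dep class_ring (module_vec TYPE(real) n) B"

text \<open>The rank of a lattice may be smaller than \<open>n\<close>. The empty basis is allowed and gives the
  zero lattice.\<close>

definition is_lattice :: "nat \<Rightarrow> real vec set \<Rightarrow> bool" where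
  "is_lattice n L \<longleftrightarrow>
     (\<exists>B. finite B \<and> B \<subseteq> carrier_vec n \<and> real_lin_indpt n B \<and>
          L = {real_lincomb n (\<lambda>b. real_of_int (c b)) B | c :: real vec \<Rightarrow> int. True})"

definition integral_lattice :: "nat \<Rightarrow> real vec set \<Rightarrow> bool" where
  "integral_lattice n L \<longleftrightarrow>
     is_lattice n L \<and> (\<forall>y1\<in>L. \<forall>y2\<in>L. scalar_prod y1 y2 \<in> \<int>)"

definition euclidean_norm :: "real vec \<Rightarrow> real" where
  "euclidean_norm y = sqrt (scalar_prod y y)"

text \<open>Since \<open>card\<close> is \<open>0\<close> on infinite sets, an upper bound on these counts is
  meaningful only together with finiteness of the sets counted.\<close>

definition N_le :: "nat \<Rightarrow> real vec set \<Rightarrow> nat" where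
  "N_le k L = card {y \<in> L. (euclidean_norm y)\<^sup>2 \<le> real k}"

definition N_eq :: "nat \<Rightarrow> real vec set \<Rightarrow> nat" where
  "N_eq k L = card {y \<in> L. (euclidean_norm y)\<^sup>2 = real k}"

end

theory Submission
  imports Defs "HOL-Library.Function_Algebras"
begin

text \<open>
  The first two bounds are instances of the polynomial method. To a vector \<open>x\<close> of squared norm \<open>a\<close>
  belongs the odd polynomial in \<open>x \<bullet> y\<close> with the zeros \<open>- (a - 1), \<dots>, a - 1\<close>. By integrality and the
  Cauchy-Schwarz inequality it vanishes at every lattice vector \<open>y\<close> that is not longer than \<open>x\<close> and
  different from \<open>x\<close> and \<open>- x\<close>. For one vector of each antipodal pair, these polynomials are linearly
  independent (\<open>card_le_of_triangular_forms\<close>), and there are at most as many of them as monomials.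

  For the asymptotic bound consider a shell, the set of vectors of squared norm exactly \<open>k\<close>. If a
  subset has no negative inner products, then the polynomials \<open>\<Prod>j<k. (x \<bullet> y - j)\<close> of degree only \<open>k\<close>
  do the same work and give the bound \<open>(n + k) choose k\<close> (\<open>card_nonneg_products\<close>). It remains to find such
  a subset that contains a fraction \<open>2 ^ (- k)\<close> of the shell, up to \<open>O(n ^ (k - 1))\<close> exceptional vectors.
  In \<open>\<int>\<^sup>n\<close> an orthant is such a subset for the vectors with \<open>k\<close> coordinates \<open>\<plusminus> 1\<close>.

  A substitute for the coordinates is built from large cliques, that is, sets of vectors with one
  common inner product \<open>i\<close>; the centre of a clique has squared norm close to \<open>i\<close>. A chain for \<open>x\<close> consists of
  cliques \<open>Q 1, \<dots>, Q (k - 1)\<close> such that the inner product of members of \<open>Q i\<close> and \<open>Q j\<close>, for \<open>i < j\<close>, and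
  of a member of \<open>Q i\<close> and \<open>x\<close>, is \<open>i\<close>. The successive differences of the centres, with \<open>x\<close> at the end,
  are then nearly orthonormal and sum to \<open>x\<close>, and the inner products between such differences for
  two vectors are nearly integers (\<open>ip_level_near_int\<close>). Hence a negative inner product is
  caused by a pair of nearly opposite differences, and a random choice of signs destroys all such pairs
  (\<open>ex_sign_consistent_subset\<close>, \<open>card_chained_le\<close>).

  That all but \<open>O(n ^ (k - 1))\<close> vectors have a chain follows from a descent (\<open>descent\<close>). Within the
  vectors attached to a clique of value \<open>c\<close>, Ramsey's theorem yields, at the cost of a factor of order \<open>n\<close>,
  a clique of a larger value with many attached vectors. As the values stay below \<open>k\<close>, at most \<open>k - c\<close>
  factors are lost, and a descent that skips a value loses fewer of them (\<open>card_unchained_le\<close>).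
\<close>

section \<open>Homogeneous forms and triangular systems\<close>

interpretation fun_space: vector_space "\<lambda>(r::real) (f :: 'b \<Rightarrow> real) y. r * f y"
  by unfold_locales (auto simp: fun_eq_iff algebra_simps)

text \<open>A form is a function on sequences \<open>nat \<Rightarrow> real\<close> of which only the first \<open>N\<close> coordinates matter.
  Indexing the monomials by lists of length \<open>N\<close> makes the dimension count a known count of
  lists with a prescribed sum.\<close>

definition exponents :: "nat \<Rightarrow> nat \<Rightarrow> nat list set" where
  "exponents N d = {l. length l = N \<and> sum_list l = d}"

definition monomial :: "nat list \<Rightarrow> (nat \<Rightarrow> real) \<Rightarrow> real" where
  "monomial l y = (\<Prod>i<length l. y i ^ (l ! i))"

definition forms :: "nat \<Rightarrow> nat \<Rightarrow> ((nat \<Rightarrow> real) \<Rightarrow> real) set" where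
  "forms N d = fun_space.span (monomial ` exponents N d)"

lemma finite_exponents: "finite (exponents N d)"
proof -
  have "exponents N d \<subseteq> {l. set l \<subseteq> {..d} \<and> length l = N}"
    by (auto simp: exponents_def dest: member_le_sum_list)
  thus ?thesis
    using finite_lists_length_eq[of "{..d}" N] finite_subset by blast
qed

lemma card_exponents: "card (exponents N d) = (d + N - 1) choose d"
  unfolding exponents_def by (rule card_length_sum_list)

lemma forms_add: "f \<in> forms N d \<Longrightarrow> h \<in> forms N d \<Longrightarrow> (\<lambda>y. f y + h y) \<in> forms N d"
  using fun_space.span_add[of f _ h] by (simp add: forms_def plus_fun_def)

lemma forms_scale: "f \<in> forms N d \<Longrightarrow> (\<lambda>y. c * f y) \<in> forms N d"
  using fun_space.span_scale[of f _ c] by (simp add: forms_def)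

lemma forms_diff: "f \<in> forms N d \<Longrightarrow> h \<in> forms N d \<Longrightarrow> (\<lambda>y. f y - h y) \<in> forms N d"
  using fun_space.span_diff[of f _ h] by (simp add: forms_def fun_diff_def)

lemma forms_zero: "(\<lambda>y. 0) \<in> forms N d"
  using fun_space.span_zero[of "monomial ` exponents N d"] by (simp add: forms_def zero_fun_def)

lemma forms_sum:
  "(\<And>i. i \<in> I \<Longrightarrow> f i \<in> forms N d) \<Longrightarrow> (\<lambda>y. \<Sum>i\<in>I. f i y) \<in> forms N d"
proof (induction I rule: infinite_finite_induct)
  case (insert i I)
  hence "(\<lambda>y. f i y + (\<Sum>i\<in>I. f i y)) \<in> forms N d"
    by (intro forms_add) simp_all
  thus ?case using insert.hyps by simp
qed (simp_all add: forms_zero)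

lemma sum_list_map2_add:
  "length l = length m \<Longrightarrow> sum_list (map2 (+) l m) = sum_list l + sum_list (m :: nat list)"
  by (induction l m rule: list_induct2) auto

lemma monomial_mult_monomial:
  assumes "l \<in> exponents N a" "m \<in> exponents N b"
  shows "(\<lambda>y. monomial l y * monomial m y) \<in> forms N (a + b)"
proof -
  have "map2 (+) l m \<in> exponents N (a + b)"
    using assms by (auto simp: exponents_def sum_list_map2_add)
  moreover have "(\<lambda>y. monomial l y * monomial m y) = monomial (map2 (+) l m)"
  proof
    fix y
    have len: "length l = N" "length m = N" using assms by (auto simp: exponents_def)
    have "monomial l y * monomial m y = (\<Prod>i<N. y i ^ (l ! i)) * (\<Prod>i<N. y i ^ (m ! i))"
      by (simp add: monomial_def len)
    also have "\<dots> = (\<Prod>i<N. y i ^ (l ! i) * y i ^ (m ! i))"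
      by (rule prod.distrib[symmetric])
    also have "\<dots> = monomial (map2 (+) l m) y"
      unfolding monomial_def by (rule prod.cong) (auto simp: len power_add)
    finally show "monomial l y * monomial m y = monomial (map2 (+) l m) y" .
  qed
  ultimately show ?thesis
    unfolding forms_def by (simp add: fun_space.span_base)
qed

lemma forms_mult:
  assumes "f \<in> forms N a" "h \<in> forms N b"
  shows "(\<lambda>y. f y * h y) \<in> forms N (a + b)"
  using assms(1)[unfolded forms_def]
proof (induction rule: fun_space.span_induct_alt)
  case base
  show ?case by (simp add: forms_zero zero_fun_def)
next
  case (step c p f')
  then obtain l where l: "l \<in> exponents N a" "p = monomial l" by auto
  have "(\<lambda>y. p y * h y) \<in> forms N (a + b)"
    using assms(2)[unfolded forms_def]
  proof (induction rule: fun_space.span_induct_alt)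
    case base
    show ?case by (simp add: forms_zero zero_fun_def)
  next
    case (step c q h')
    then obtain m where "m \<in> exponents N b" "q = monomial m" by auto
    from monomial_mult_monomial[OF l(1) this(1)] this(2) l(2)
    have "(\<lambda>y. p y * q y) \<in> forms N (a + b)" by simp
    from forms_add[OF forms_scale[OF this, of c] step(2)]
    show ?case by (simp add: plus_fun_def algebra_simps)
  qed
  from forms_add[OF forms_scale[OF this, of c] step(2)]
  show ?case by (simp add: plus_fun_def algebra_simps)
qed

lemma forms_const: "(\<lambda>y. c) \<in> forms N 0"
proof -
  have "monomial (replicate N 0) \<in> forms N 0"
    unfolding forms_def by (rule fun_space.span_base) (simp add: exponents_def sum_list_replicate)
  from forms_scale[OF this, of c] show ?thesis by (simp add: monomial_def)
qed

lemma forms_coord: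
  assumes "i < N"
  shows "(\<lambda>y. y i) \<in> forms N 1"
proof -
  have "(replicate N 0)[i := 1] \<in> exponents N 1"
    using assms by (simp add: exponents_def sum_list_update sum_list_replicate)
  moreover have "monomial ((replicate N 0)[i := 1]) = (\<lambda>y. y i)"
  proof
    fix y :: "nat \<Rightarrow> real"
    have "monomial ((replicate N 0)[i := 1]) y = (\<Prod>j<N. if j = i then y i else 1)"
      unfolding monomial_def by (rule prod.cong) (auto simp: nth_list_update)
    thus "monomial ((replicate N 0)[i := 1]) y = y i"
      using assms by simp
  qed
  ultimately show ?thesis
    unfolding forms_def by (metis fun_space.span_base imageI)
qed

lemma forms_linear:
  assumes "n \<le> N"
  shows "(\<lambda>y. \<Sum>i<n. a i * y i) \<in> forms N 1"
  by (rule forms_sum, rule forms_scale, rule forms_coord) (use assms in auto)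

lemma forms_prod:
  assumes "finite I" "\<And>i. i \<in> I \<Longrightarrow> f i \<in> forms N d"
  shows "(\<lambda>y. \<Prod>i\<in>I. f i y) \<in> forms N (card I * d)"
  using assms
proof (induction I rule: finite_induct)
  case (insert i I)
  hence "(\<lambda>y. f i y * (\<Prod>i\<in>I. f i y)) \<in> forms N (d + card I * d)"
    by (intro forms_mult) simp_all
  thus ?case using insert.hyps by simp
qed (simp add: forms_const)

lemma forms_power:
  assumes "f \<in> forms N d"
  shows "(\<lambda>y. f y ^ m) \<in> forms N (m * d)"
proof (induction m)
  case (Suc m)
  thus ?case using forms_mult[OF assms Suc.IH] by simp
qed (simp add: forms_const)

text \<open>Forms whose matrix of values at the points \<open>p x\<close> is triangular with nonzero diagonal are linearly
  independent: in a vanishing combination, evaluate at the point of least \<open>\<rho>\<close> among those that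
  carry a nonzero coefficient; all other terms vanish there. So there are at most as many of
  them as monomials. Finiteness of \<open>X\<close> is part of the conclusion, which is how the
  discreteness of short vectors is obtained below.\<close>

lemma card_le_of_triangular_forms:
  fixes f :: "'a \<Rightarrow> (nat \<Rightarrow> real) \<Rightarrow> real" and p :: "'a \<Rightarrow> nat \<Rightarrow> real" and \<rho> :: "'a \<Rightarrow> nat"
  assumes forms: "\<And>x. x \<in> X \<Longrightarrow> f x \<in> forms N d"
    and diag: "\<And>x. x \<in> X \<Longrightarrow> f x (p x) \<noteq> 0"
    and tri: "\<And>x y. x \<in> X \<Longrightarrow> y \<in> X \<Longrightarrow> x \<noteq> y \<Longrightarrow> \<rho> y \<le> \<rho> x \<Longrightarrow> f x (p y) = 0"
  shows "finite X \<and> card X \<le> (d + N - 1) choose d"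
proof -
  have inj: "inj_on f X"
    by (rule inj_onI) (metis diag tri nat_le_linear)
  have indep: "u v = 0"
    if t: "finite t" "t \<subseteq> f ` X" "(\<Sum>v\<in>t. (\<lambda>y. u v * v y)) = 0" "v \<in> t"
    for t v and u :: "((nat \<Rightarrow> real) \<Rightarrow> real) \<Rightarrow> real"
  proof (rule ccontr)
    assume "u v \<noteq> 0"
    define g where "g = inv_into X f"
    have g: "g w \<in> X" "f (g w) = w" if "w \<in> t" for w
      using that t(2) by (auto simp: g_def inv_into_into f_inv_into_f)
    define t' where "t' = {w\<in>t. u w \<noteq> 0}"
    have t': "finite t'" "t' \<noteq> {}" using t \<open>u v \<noteq> 0\<close> by (auto simp: t'_def)
    define w where "w = arg_min_on (\<lambda>w. \<rho> (g w)) t'"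
    have w: "w \<in> t'" "\<And>z. z \<in> t' \<Longrightarrow> \<rho> (g w) \<le> \<rho> (g z)"
      using arg_min_if_finite[OF t', of "\<lambda>w. \<rho> (g w)"] 
      by (auto simp: w_def not_less)
    have wt: "w \<in> t" using w(1) by (simp add: t'_def)
    have zero: "u z * z (p (g w)) = 0" if "z \<in> t - {w}" for z
    proof (cases "u z = 0")
      case False
      hence "z \<in> t'" using that by (simp add: t'_def)
      have "g z \<noteq> g w" using g that wt by (metis DiffD1 DiffD2 singletonI)
      from tri[OF g(1) g(1) this w(2)[OF \<open>z \<in> t'\<close>]] that wt g(2)[of z] show ?thesis by auto
    qed auto
    have rest: "(\<Sum>z\<in>t - {w}. u z * z (p (g w))) = 0"
      by (rule sum.neutral) (use zero in blast)
    have "0 = (\<Sum>v\<in>t. (\<lambda>y. u v * v y)) (p (g w))" using t(3) by simp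
    also have "\<dots> = (\<Sum>z\<in>t. u z * z (p (g w)))"
      by (induction t rule: infinite_finite_induct) auto
    also have "\<dots> = u w * w (p (g w))"
      using sum.remove[OF t(1) wt, of "\<lambda>z. u z * z (p (g w))"] rest by simp
    finally show False
      using diag[OF g(1)[OF wt]] g(2)[OF wt] w(1) by (simp add: t'_def)
  qed
  have ind: "fun_space.independent (f ` X)"
    unfolding fun_space.independent_explicit_module using indep by blast
  have sub: "f ` X \<subseteq> fun_space.span (monomial ` exponents N d)"
    using forms by (auto simp: forms_def)
  have "finite (f ` X) \<and> card (f ` X) \<le> card (monomial ` exponents N d)"
    by (rule fun_space.independent_span_bound[OF finite_imageI[OF finite_exponents] ind sub])
  moreover have "card (monomial ` exponents N d) \<le> (d + N - 1) choose d"
    using card_image_le[OF finite_exponents, of monomial N d] by (simp add: card_exponents)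
  ultimately show ?thesis
    using inj by (auto simp: card_image finite_image_iff)
qed

section \<open>The polynomial bounds for lattice vectors\<close>

text \<open>The constant coordinate \<open>1\<close> in place \<open>n\<close> lets forms in \<open>n + 1\<close> variables stand for
  inhomogeneous polynomials in \<open>n\<close> variables; forms in \<open>n\<close> variables do not see it.\<close>

definition affine_coords :: "nat \<Rightarrow> real vec \<Rightarrow> nat \<Rightarrow> real" where
  "affine_coords n y i = (if i < n then y $ i else 1)"

lemma scalar_prod_affine_coords:
  assumes "y \<in> carrier_vec n"
  shows "scalar_prod x y = (\<Sum>i<n. x $ i * affine_coords n y i)"
  using assms by (auto simp: scalar_prod_def affine_coords_def atLeast0LessThan intro!: sum.cong)

lemma scalar_prod_self_pos:
  fixes x :: "real vec"
  assumes "x \<in> carrier_vec n" "x \<noteq> 0\<^sub>v n"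
  shows "scalar_prod x x > 0"
proof -
  obtain i where i: "i < n" "x $ i \<noteq> 0"
    using assms by (metis carrier_vecD eq_vecI index_zero_vec)
  hence "0 < x $ i * x $ i" by (metis not_real_square_gt_zero)
  hence "0 < (\<Sum>i\<in>{0..<n}. x $ i * x $ i)"
    using i(1) by (intro sum_pos2[of _ i]) auto
  thus ?thesis using assms(1) by (simp add: scalar_prod_def)
qed

text \<open>Both \<open>x - y\<close> and \<open>x + y\<close> are nonzero, so their squared norms, which are at most
  \<open>2 * a - 2 * (x \<bullet> y)\<close> and \<open>2 * a + 2 * (x \<bullet> y)\<close>, are positive.\<close>

lemma abs_scalar_prod_less:
  fixes x y :: "real vec"
  assumes carr: "x \<in> carrier_vec n" "y \<in> carrier_vec n" and neq: "x \<noteq> y" "x \<noteq> - y"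
    and norms: "scalar_prod x x = real a" "scalar_prod y y = real b" "b \<le> a"
  shows "\<bar>scalar_prod x y\<bar> < real a"
proof -
  have "x - y \<noteq> 0\<^sub>v n"
  proof
    assume "x - y = 0\<^sub>v n"
    hence "x $ i = y $ i" if "i < n" for i
      using that carr by (metis carrier_vecD eq_iff_diff_eq_0 index_minus_vec(1) index_zero_vec(1))
    thus False using neq(1) carr by (metis carrier_vecD eq_vecI)
  qed
  moreover have "x + y \<noteq> 0\<^sub>v n"
  proof
    assume *: "x + y = 0\<^sub>v n"
    have "x $ i = - y $ i" if "i < n" for i
    proof -
      have "(x + y) $ i = 0" using * that by simp
      thus ?thesis using that carr by simp
    qed
    thus False using neq(2) carr by (auto intro!: eq_vecI)
  qed
  ultimately have "scalar_prod (x - y) (x - y) > 0" "scalar_prod (x + y) (x + y) > 0"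
    using carr by (auto intro!: scalar_prod_self_pos[of _ n])
  moreover have "scalar_prod (x - y) (x - y) = scalar_prod x x - 2 * scalar_prod x y + scalar_prod y y"
    using carr by (simp add: minus_scalar_prod_distrib[of _ n] scalar_prod_minus_distrib[of _ n]
        comm_scalar_prod[of y n x])
  moreover have "scalar_prod (x + y) (x + y) = scalar_prod x x + 2 * scalar_prod x y + scalar_prod y y"
    using carr by (simp add: add_scalar_prod_distrib[of _ n] scalar_prod_add_distrib[of _ n]
        comm_scalar_prod[of y n x])
  ultimately show ?thesis using norms by auto
qed

text \<open>The polynomials used below are odd, so they cannot separate \<open>x\<close> from \<open>- x\<close>; this lemma
  keeps one vector of each antipodal pair.\<close>

lemma ex_half_set:
  fixes S :: "real vec set"
  shows "\<exists>X\<subseteq>S. S \<subseteq> X \<union> uminus ` X \<and> (\<forall>x\<in>X. \<forall>y\<in>X. x \<noteq> y \<longrightarrow> x \<noteq> - y)"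
proof -
  define rep where "rep y = (SOME z. z \<in> S \<and> (z = y \<or> z = - y))" for y
  have rep: "rep y \<in> S" "rep y = y \<or> rep y = - y" if "y \<in> S" for y
    using someI[of "\<lambda>z. z \<in> S \<and> (z = y \<or> z = - y)" y] that by (auto simp: rep_def)
  have rep_minus: "rep (- y) = rep y" for y
    unfolding rep_def by (rule arg_cong[where f = Eps]) (auto simp: fun_eq_iff)
  have rep_rep: "rep x = x" if "x \<in> rep ` S" for x
    using that rep rep_minus by (metis imageE)
  have "S \<subseteq> rep ` S \<union> uminus ` rep ` S"
  proof
    fix y assume y: "y \<in> S"
    hence "y = rep y \<or> y = - rep y" using rep(2)[OF y] by auto
    thus "y \<in> rep ` S \<union> uminus ` rep ` S" using y by blast
  qed
  moreover have "\<forall>x\<in>rep ` S. \<forall>y\<in>rep ` S. x \<noteq> y \<longrightarrow> x \<noteq> - y"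
    using rep_rep rep_minus by metis
  moreover have "rep ` S \<subseteq> S" using rep by auto
  ultimately show ?thesis by blast
qed

text \<open>The odd polynomial with the zeros \<open>- (a - 1), \<dots>, a - 1\<close> kills every inner product that a
  vector of squared norm \<open>a\<close> can have with a vector that is not longer and not \<open>\<plusminus>\<close> itself, while
  its value at \<open>a\<close> is nonzero.\<close>

lemma odd_product_zero:
  fixes z :: int
  assumes "\<bar>z\<bar> < int a"
  shows "real_of_int z * (\<Prod>j\<in>{1..<a}. (real_of_int z)\<^sup>2 - (real j)\<^sup>2) = 0"
proof (cases "z = 0")
  case False
  hence "nat \<bar>z\<bar> \<in> {1..<a}" using assms by auto
  moreover have "(real_of_int z)\<^sup>2 - (real (nat \<bar>z\<bar>))\<^sup>2 = 0" by simp
  ultimately have "(\<Prod>j\<in>{1..<a}. (real_of_int z)\<^sup>2 - (real j)\<^sup>2) = 0"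
    by (metis (no_types, lifting) finite_atLeastLessThan prod_zero)
  thus ?thesis by simp
qed auto

lemma odd_product_nonzero:
  assumes "a > 0"
  shows "real a * (\<Prod>j\<in>{1..<a}. (real a)\<^sup>2 - (real j)\<^sup>2) \<noteq> 0"
  using assms by (auto simp: power2_eq_iff)

text \<open>A vector \<open>x\<close> of squared norm \<open>a\<close> is assigned the odd polynomial above in the variable
  \<open>x \<bullet> y\<close>, homogenised to degree \<open>2 * k - 1\<close>. Ordered by norm, these form a triangular system.
  All of them vanish at the origin, so the constant polynomial can be added to the system, with
  the origin as its point; this saves one unit in the count of half of the nonzero vectors and
  accounts for the \<open>- 1\<close> in the bound.\<close>

lemma integral_vectors_bound:
  fixes S :: "real vec set"
  assumes carr: "S \<subseteq> carrier_vec n"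
    and int: "\<And>x y. x \<in> S \<Longrightarrow> y \<in> S \<Longrightarrow> scalar_prod x y \<in> \<int>"
    and norm: "\<And>x. x \<in> S \<Longrightarrow> scalar_prod x x \<le> real k" and k: "k > 0"
  shows "finite S \<and> card S \<le> 2 * ((n + 2 * k - 1) choose (2 * k - 1)) - 1"
proof -
  define S' where "S' = S - {0\<^sub>v n}"
  obtain X where X: "X \<subseteq> S'" "S' \<subseteq> X \<union> uminus ` X"
    and half: "\<And>x y. x \<in> X \<Longrightarrow> y \<in> X \<Longrightarrow> x \<noteq> y \<Longrightarrow> x \<noteq> - y"
    using ex_half_set[of S'] by metis
  have XS: "x \<in> S" "x \<in> carrier_vec n" "x \<noteq> 0\<^sub>v n" if "x \<in> X" for x
    using that X(1) carr by (auto simp: S'_def)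
  define a where "a x = nat \<lfloor>scalar_prod x x\<rfloor>" for x :: "real vec"
  have a: "scalar_prod x x = real (a x)" "0 < a x" "a x \<le> k" if "x \<in> X" for x
  proof -
    have "scalar_prod x x \<in> \<int>" "scalar_prod x x > 0" "scalar_prod x x \<le> real k"
      using int norm XS[OF that] scalar_prod_self_pos by auto
    thus "scalar_prod x x = real (a x)" "0 < a x" "a x \<le> k"
      by (auto simp: a_def elim!: Ints_cases)
  qed
  have zX: "0\<^sub>v n \<notin> X" using XS(3) by blast
  have a0: "a (0\<^sub>v n) = 0" by (simp add: a_def)
  define lin where "lin x y = (\<Sum>i<n. x $ i * y i)" for x :: "real vec" and y :: "nat \<Rightarrow> real"
  have lin: "lin x (affine_coords n y) = scalar_prod x y" if "y \<in> carrier_vec n" for x y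
    using scalar_prod_affine_coords[OF that] by (simp add: lin_def)
  have one: "affine_coords n y n = 1" for y by (simp add: affine_coords_def)
  \<comment> \<open>The homogenising variable is the last one, and it has the value \<open>1\<close> at every point.\<close>
  define f where "f x = (if x = 0\<^sub>v n then (\<lambda>y. y n ^ (2 * k - 1))
      else (\<lambda>y. lin x y * (\<Prod>j\<in>{1..<a x}. (lin x y)\<^sup>2 - (real j)\<^sup>2 * (y n)\<^sup>2)
             * y n ^ (2 * (k - a x))))" for x
  have "finite (insert (0\<^sub>v n) X) \<and>
      card (insert (0\<^sub>v n) X) \<le> (2 * k - 1 + (n + 1) - 1) choose (2 * k - 1)"
  proof (rule card_le_of_triangular_forms[where f = f and p = "affine_coords n" and \<rho> = a])
    fix x assume x: "x \<in> insert (0\<^sub>v n) X"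
    show "f x \<in> forms (n + 1) (2 * k - 1)"
    proof (cases "x = 0\<^sub>v n")
      case True
      show ?thesis using forms_power[OF forms_coord[of n "n + 1"], of "2 * k - 1"] True
        by (simp add: f_def)
    next
      case False
      hence "x \<in> X" using x by simp
      have l: "lin x \<in> forms (n + 1) 1"
        unfolding lin_def by (rule forms_linear) simp
      have c: "(\<lambda>y. y n) \<in> forms (n + 1) 1" by (rule forms_coord) simp
      have "(\<lambda>y. (lin x y)\<^sup>2 - (real j)\<^sup>2 * (y n)\<^sup>2) \<in> forms (n + 1) (2 * 1)" for j
        by (intro forms_diff forms_scale forms_power l c)
      from forms_prod[of "{1..<a x}", OF _ this]
      have "(\<lambda>y. \<Prod>j\<in>{1..<a x}. (lin x y)\<^sup>2 - (real j)\<^sup>2 * (y n)\<^sup>2) \<in> forms (n + 1) ((a x - 1) * 2)"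
        by simp
      from forms_mult[OF forms_mult[OF l this] forms_power[OF c, of "2 * (k - a x)"]]
      moreover have "1 + (a x - 1) * 2 + 2 * (k - a x) * 1 = 2 * k - 1"
        using a(2,3)[OF \<open>x \<in> X\<close>] by simp
      ultimately show ?thesis using False by (simp add: f_def)
    qed
    show "f x (affine_coords n x) \<noteq> 0"
    proof (cases "x = 0\<^sub>v n")
      case False
      hence "x \<in> X" using x by simp
      thus ?thesis using odd_product_nonzero[OF a(2), of x]
        by (simp add: f_def False lin XS one a(1))
    qed (simp add: f_def one)
  next
    fix x y assume xy: "x \<in> insert (0\<^sub>v n) X" "y \<in> insert (0\<^sub>v n) X" "x \<noteq> y" "a y \<le> a x"
    have x: "x \<in> X"
    proof (rule ccontr)
      assume "x \<notin> X"
      hence "x = 0\<^sub>v n" "y \<in> X" using xy by auto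
      thus False using xy(4) a0 a(2)[of y] by simp
    qed
    show "f x (affine_coords n y) = 0"
    proof (cases "y = 0\<^sub>v n")
      case True
      thus ?thesis using XS[OF x] lin[of y x] by (simp add: f_def)
    next
      case False
      hence y: "y \<in> X" using xy by simp
      obtain z :: int where z: "scalar_prod x y = real_of_int z"
        using int[OF XS(1)[OF x] XS(1)[OF y]] by (auto elim: Ints_cases)
      have "\<bar>scalar_prod x y\<bar> < real (a x)"
        using abs_scalar_prod_less[OF XS(2)[OF x] XS(2)[OF y] xy(3) half[OF x y xy(3)] a(1)[OF x] a(1)[OF y] xy(4)] .
      hence "\<bar>z\<bar> < int (a x)" unfolding z by linarith
      from odd_product_zero[OF this] show ?thesis
        using XS[OF x] XS[OF y] by (simp add: f_def lin one z)
    qed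
  qed
  hence fin: "finite X" and card: "Suc (card X) \<le> (n + 2 * k - 1) choose (2 * k - 1)"
    using zX k by (auto simp: algebra_simps)
  have "S \<subseteq> insert (0\<^sub>v n) (X \<union> uminus ` X)" using X(2) by (auto simp: S'_def)
  moreover have "card (insert (0\<^sub>v n) (X \<union> uminus ` X)) \<le> Suc (card X + card X)"
    using fin card_Un_le[of X "uminus ` X"] card_image_le[OF fin, of uminus]
    by (intro order_trans[OF card_insert_le_m1]) (auto simp: card_insert_if)
  ultimately have "card S \<le> Suc (card X + card X)" "finite S"
    using fin card_mono[of "insert (0\<^sub>v n) (X \<union> uminus ` X)" S] finite_subset by fastforce+
  thus ?thesis using card by linarith
qed

text \<open>On the sphere of squared norm \<open>k\<close> the constant \<open>1\<close> is itself the quadratic form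
  \<open>(y \<bullet> y) / k\<close>, so no additional variable is needed to homogenise.\<close>

lemma integral_shell_bound:
  fixes S :: "real vec set"
  assumes carr: "S \<subseteq> carrier_vec n" and n: "n > 0"
    and int: "\<And>x y. x \<in> S \<Longrightarrow> y \<in> S \<Longrightarrow> scalar_prod x y \<in> \<int>"
    and norm: "\<And>x. x \<in> S \<Longrightarrow> scalar_prod x x = real k" and k: "k > 0"
  shows "card S \<le> 2 * ((n + 2 * k - 2) choose (2 * k - 1))"
proof -
  obtain X where X: "X \<subseteq> S" "S \<subseteq> X \<union> uminus ` X"
    and half: "\<And>x y. x \<in> X \<Longrightarrow> y \<in> X \<Longrightarrow> x \<noteq> y \<Longrightarrow> x \<noteq> - y"
    using ex_half_set[of S] by metis
  have XS: "x \<in> S" "x \<in> carrier_vec n" if "x \<in> X" for x using that X(1) carr by auto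
  define lin where "lin x y = (\<Sum>i<n. x $ i * y i)" for x :: "real vec" and y :: "nat \<Rightarrow> real"
  define quad where "quad y = (\<Sum>i<n. y i * y i)" for y :: "nat \<Rightarrow> real"
  have lin: "lin x (affine_coords n y) = scalar_prod x y" if "y \<in> carrier_vec n" for x y
    using scalar_prod_affine_coords[OF that] by (simp add: lin_def)
  have quad: "quad (affine_coords n y) = real k" if "y \<in> X" for y
    using norm[OF XS(1)[OF that]] scalar_prod_affine_coords[OF XS(2)[OF that], of y]
    by (simp add: quad_def affine_coords_def)
  define f where "f x = (\<lambda>y. lin x y * (\<Prod>j\<in>{1..<k}. (lin x y)\<^sup>2 - ((real j)\<^sup>2 / k) * quad y))" for x
  have "finite X \<and> card X \<le> (2 * k - 1 + n - 1) choose (2 * k - 1)"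
  proof (rule card_le_of_triangular_forms[where f = f and p = "affine_coords n" and \<rho> = "\<lambda>_. 0"])
    fix x assume x: "x \<in> X"
    have l: "lin x \<in> forms n 1"
      unfolding lin_def by (rule forms_linear) simp
    have "(\<lambda>y. y i * y i) \<in> forms n (1 + 1)" if "i < n" for i
      using that by (intro forms_mult forms_coord)
    hence "quad \<in> forms n (2 * 1)"
      unfolding quad_def by (intro forms_sum) (auto simp: numeral_2_eq_2)
    hence "(\<lambda>y. (lin x y)\<^sup>2 - ((real j)\<^sup>2 / k) * quad y) \<in> forms n (2 * 1)" for j
      by (intro forms_diff forms_scale forms_power l)
    from forms_prod[of "{1..<k}", OF _ this]
    have pr: "(\<lambda>y. \<Prod>j\<in>{1..<k}. (lin x y)\<^sup>2 - ((real j)\<^sup>2 / k) * quad y) \<in> forms n ((k - 1) * 2)"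
      by simp
    have "1 + (k - 1) * 2 = 2 * k - 1" using k by simp
    thus "f x \<in> forms n (2 * k - 1)"
      using forms_mult[OF l pr] by (simp add: f_def)
    show "f x (affine_coords n x) \<noteq> 0"
      using odd_product_nonzero[OF k] k by (simp add: f_def lin XS x quad norm)
  next
    fix x y assume x: "x \<in> X" and y: "y \<in> X" and xy: "x \<noteq> y"
    obtain z :: int where z: "scalar_prod x y = real_of_int z"
      using int[OF XS(1)[OF x] XS(1)[OF y]] by (auto elim: Ints_cases)
    have "\<bar>scalar_prod x y\<bar> < real k"
      using abs_scalar_prod_less[OF XS(2)[OF x] XS(2)[OF y] xy half[OF x y xy]
          norm[OF XS(1)[OF x]] norm[OF XS(1)[OF y]]] by simp
    hence "\<bar>z\<bar> < int k" unfolding z by linarith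
    from odd_product_zero[OF this] show "f x (affine_coords n y) = 0"
      using k by (simp add: f_def lin XS y z quad)
  qed
  hence fin: "finite X" and card: "card X \<le> (n + 2 * k - 2) choose (2 * k - 1)"
    using k n by (auto simp: algebra_simps numeral_2_eq_2)
  have "card S \<le> card (X \<union> uminus ` X)"
    using X(2) fin by (intro card_mono) auto
  also have "\<dots> \<le> card X + card X"
    using card_Un_le[of X "uminus ` X"] card_image_le[OF fin, of uminus] by linarith
  finally show ?thesis using card by linarith
qed

section \<open>Inner products of coordinate sequences\<close>

text \<open>Working with all of \<open>nat \<Rightarrow> real\<close> instead of vectors of dimension \<open>n\<close> removes carrier
  conditions; the form is then only positive semidefinite.\<close>

definition ip :: "nat \<Rightarrow> (nat \<Rightarrow> real) \<Rightarrow> (nat \<Rightarrow> real) \<Rightarrow> real" where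
  "ip n a b = (\<Sum>i<n. a i * b i)"

lemma ip_commute: "ip n a b = ip n b a"
  by (simp add: ip_def mult.commute)

lemma ip_self_nonneg: "0 \<le> ip n a a"
  by (simp add: ip_def sum_nonneg)

lemma ip_add_left: "ip n (\<lambda>i. a i + b i) w = ip n a w + ip n b w"
  by (simp add: ip_def distrib_right sum.distrib)

lemma ip_diff_left: "ip n (\<lambda>i. a i - b i) w = ip n a w - ip n b w"
  by (simp add: ip_def left_diff_distrib sum_subtractf)

lemma ip_scale_left: "ip n (\<lambda>i. c * a i) w = c * ip n a w"
  by (simp add: ip_def sum_distrib_left mult.assoc)

lemma ip_zero_left: "ip n (\<lambda>i. 0) w = 0"
  by (simp add: ip_def)

lemma ip_add_right: "ip n w (\<lambda>i. a i + b i) = ip n w a + ip n w b"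
  by (metis ip_add_left ip_commute)

lemma ip_diff_right: "ip n w (\<lambda>i. a i - b i) = ip n w a - ip n w b"
  by (metis ip_diff_left ip_commute)

lemma ip_scale_right: "ip n w (\<lambda>i. c * a i) = c * ip n w a"
  by (metis ip_scale_left ip_commute)

lemma ip_zero_right: "ip n w (\<lambda>i. 0) = 0"
  by (simp add: ip_def)

lemma ip_sum_left: "ip n (\<lambda>i. \<Sum>x\<in>F. f x i) w = (\<Sum>x\<in>F. ip n (f x) w)"
  unfolding ip_def sum_distrib_right by (rule sum.swap)

lemma ip_sum_right: "ip n w (\<lambda>i. \<Sum>x\<in>F. f x i) = (\<Sum>x\<in>F. ip n w (f x))"
  by (subst (1 2) ip_commute) (rule ip_sum_left)

lemma ip_comb:
  "ip n (\<lambda>i. \<Sum>x\<in>F. a x * f x i) (\<lambda>i. \<Sum>y\<in>G. b y * h y i) =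
     (\<Sum>x\<in>F. \<Sum>y\<in>G. a x * b y * ip n (f x) (h y))"
  by (simp add: ip_sum_left ip_sum_right ip_scale_left ip_scale_right sum_distrib_left algebra_simps)

lemma ip_Cauchy_Schwarz: "(ip n a b)\<^sup>2 \<le> ip n a a * ip n b b"
proof (cases "ip n b b = 0")
  case True
  hence "b i = 0" if "i < n" for i
    using that sum_nonneg_eq_0_iff[of "{..<n}" "\<lambda>i. b i * b i"] by (simp add: ip_def)
  hence "ip n a b = 0" by (simp add: ip_def)
  thus ?thesis using True by simp
next
  case False
  hence pos: "ip n b b > 0" using ip_self_nonneg[of n b] by linarith
  have "0 \<le> ip n (\<lambda>i. ip n b b * a i - ip n a b * b i) (\<lambda>i. ip n b b * a i - ip n a b * b i)"
    by (rule ip_self_nonneg)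
  also have "\<dots> = ip n b b * (ip n a a * ip n b b - (ip n a b)\<^sup>2)"
    by (simp add: ip_diff_left ip_diff_right ip_scale_left ip_scale_right ip_commute[of n b a])
      (simp add: algebra_simps power2_eq_square)
  finally show ?thesis using pos by (simp add: zero_le_mult_iff)
qed

section \<open>Two counting principles\<close>

lemma ex_large_fibre:
  assumes "finite A" "f ` A \<subseteq> B" "finite B" "card B * m < card A"
  shows "\<exists>b\<in>B. m < card {x\<in>A. f x = b}"
proof (rule ccontr)
  assume "\<not> ?thesis"
  hence le: "card {x\<in>A. f x = b} \<le> m" if "b \<in> B" for b using that by auto
  have "A = (\<Union>b\<in>B. {x\<in>A. f x = b})" using assms(2) by auto
  hence "card A \<le> (\<Sum>b\<in>B. card {x\<in>A. f x = b})"
    using card_UN_le[OF assms(3), of "\<lambda>b. {x\<in>A. f x = b}"] by simp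
  also have "\<dots> \<le> card B * m" using sum_mono[of B _ "\<lambda>_. m"] le by simp
  finally show False using assms(4) by simp
qed

text \<open>An independent set of the largest possible size is also dominating.\<close>

lemma ex_dominating_independent:
  assumes "finite A" and sym: "\<And>x y. x \<in> A \<Longrightarrow> y \<in> A \<Longrightarrow> R x y \<Longrightarrow> R y x"
  shows "\<exists>F\<subseteq>A. (\<forall>x\<in>F. \<forall>y\<in>F. x \<noteq> y \<longrightarrow> \<not> R x y) \<and> (\<forall>y\<in>A - F. \<exists>x\<in>F. R x y)"
proof -
  let ?P = "\<lambda>F. F \<subseteq> A \<and> (\<forall>x\<in>F. \<forall>y\<in>F. x \<noteq> y \<longrightarrow> \<not> R x y)"
  have "\<exists>F. ?P F \<and> (\<forall>G. ?P G \<longrightarrow> card G \<le> card F)"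
    by (rule ex_has_greatest_nat[of ?P "{}" card "Suc (card A)"])
      (use assms(1) in \<open>auto simp: less_Suc_eq_le intro: card_mono\<close>)
  then obtain F where F: "?P F" and max: "\<And>G. ?P G \<Longrightarrow> card G \<le> card F" by blast
  have "\<exists>x\<in>F. R x y" if "y \<in> A - F" for y
  proof (rule ccontr)
    assume "\<not> ?thesis"
    hence "?P (insert y F)" using F that sym by blast
    from max[OF this] show False
      using that F finite_subset[OF _ assms(1)] by (simp add: card_insert_if)
  qed
  thus ?thesis using F by blast
qed

section \<open>Integral shells\<close>

text \<open>Replacing the centre of a clique by a suitable member changes an inner product with a vector of
  squared norm at most \<open>k\<close> by at most \<open>k / sqrt (clique_size k)\<close>. The square makes this error
  rational, namely \<open>1 / (800 * k\<^sup>2)\<close>, and it is so small that eight such errors in each of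
  \<open>k\<^sup>2\<close> inner products sum to only \<open>1 / 100\<close>.\<close>

definition clique_size :: "nat \<Rightarrow> nat" where
  "clique_size k = (800 * k ^ 3)\<^sup>2"

text \<open>A vertex is picked \<open>2 * k * clique_size k\<close> times, and each time the remaining set is restricted
  to one of the \<open>2 * k\<close> possible inner products with it.\<close>

definition ramsey_bound :: "nat \<Rightarrow> nat" where
  "ramsey_bound k = (2 * k + 2) ^ (2 * k * clique_size k)"

definition descent_factor :: "nat \<Rightarrow> nat" where
  "descent_factor k = 2 * (4 * k\<^sup>2 + 1) * (1 + 2 * ramsey_bound k)"

text \<open>The vectors are indexed by an arbitrary type, and \<open>g\<close> is their integral Gram matrix. The
  last assumption is the strict Cauchy-Schwarz inequality for distinct vectors of the same norm.\<close>

locale integral_shell =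
  fixes n k :: nat and X :: "'a set" and v :: "'a \<Rightarrow> nat \<Rightarrow> real" and g :: "'a \<Rightarrow> 'a \<Rightarrow> int"
  assumes n_pos: "0 < n" and k_pos: "0 < k" and finite_X: "finite X"
    and g_ip: "\<And>x y. x \<in> X \<Longrightarrow> y \<in> X \<Longrightarrow> real_of_int (g x y) = ip n (v x) (v y)"
    and g_self: "\<And>x. x \<in> X \<Longrightarrow> g x x = int k"
    and g_less: "\<And>x y. x \<in> X \<Longrightarrow> y \<in> X \<Longrightarrow> x \<noteq> y \<Longrightarrow> g x y < int k"
begin

abbreviation "T \<equiv> clique_size k"

lemma T_large: "8 * k\<^sup>2 < T"
proof -
  have "k\<^sup>2 \<le> k ^ 6" using k_pos by (intro power_increasing) auto
  moreover have "T = 640000 * k ^ 6" by (simp add: clique_size_def power_mult_distrib flip: power_mult)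
  moreover have "0 < k\<^sup>2" using k_pos by simp
  ultimately show ?thesis by linarith
qed

lemma T_pos: "0 < T" using T_large by simp

lemma finite_sub: "A \<subseteq> X \<Longrightarrow> finite A"
  using finite_X finite_subset by blast

lemma g_commute: "x \<in> X \<Longrightarrow> y \<in> X \<Longrightarrow> g x y = g y x"
  using g_ip[of x y] g_ip[of y x] by (simp add: ip_commute)

lemma g_lower:
  assumes "x \<in> X" "y \<in> X"
  shows "- int k \<le> g x y"
proof -
  have "0 \<le> ip n (\<lambda>i. v x i + v y i) (\<lambda>i. v x i + v y i)" by (rule ip_self_nonneg)
  also have "\<dots> = 2 * real k + 2 * real_of_int (g x y)"
    using assms g_ip[of x x] g_ip[of y y] g_ip[of x y] g_self
    by (simp add: ip_add_left ip_add_right ip_commute[of n "v y" "v x"])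
  finally have "- real k \<le> real_of_int (g x y)" by linarith
  thus ?thesis by linarith
qed

text \<open>If all vectors of \<open>A\<close> have the same inner product \<open>c\<close> with a vector \<open>u\<close> of squared norm
  \<open>c + \<delta>\<close>, then \<open>g x y - c + \<delta>\<close> is the Gram matrix of the vectors \<open>v x - u\<close>. Recording only
  that it is positive semidefinite treats all stages of the descent below alike, including the
  initial one with \<open>u = 0\<close>.\<close>

definition psd_shift :: "nat \<Rightarrow> real \<Rightarrow> 'a set \<Rightarrow> bool" where
  "psd_shift c \<delta> A \<longleftrightarrow>
     (\<forall>F a. F \<subseteq> A \<longrightarrow> 0 \<le> (\<Sum>x\<in>F. \<Sum>y\<in>F. a x * a y * (real_of_int (g x y) - real c + \<delta>)))"

lemma psd_shift_zero:
  assumes "A \<subseteq> X"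
  shows "psd_shift 0 0 A"
  unfolding psd_shift_def
proof (intro allI impI)
  fix F :: "'a set" and a :: "'a \<Rightarrow> real"
  assume "F \<subseteq> A"
  hence "(\<Sum>x\<in>F. \<Sum>y\<in>F. a x * a y * (real_of_int (g x y) - real 0 + 0)) =
      ip n (\<lambda>i. \<Sum>x\<in>F. a x * v x i) (\<lambda>i. \<Sum>x\<in>F. a x * v x i)"
    unfolding ip_comb using assms by (intro sum.cong) (auto simp: g_ip subset_iff)
  thus "0 \<le> (\<Sum>x\<in>F. \<Sum>y\<in>F. a x * a y * (real_of_int (g x y) - real 0 + 0))"
    by (simp add: ip_self_nonneg)
qed

text \<open>After the shift, the vectors of \<open>F\<close> are almost pairwise non-acute but all correlate with \<open>x\<close> in
  the same direction; a bounded squared norm permits this only for boundedly many vectors.\<close>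

lemma star_bound:
  assumes A: "A \<subseteq> X" "psd_shift c \<delta> A" and \<delta>: "0 \<le> \<delta>" "\<delta> \<le> 1 / (8 * real k)"
    and x: "x \<in> A" "x \<notin> F" and F: "F \<subseteq> A" and \<sigma>: "\<sigma> = 1 \<or> \<sigma> = (-1::real)"
    and star: "\<And>y. y \<in> F \<Longrightarrow> \<sigma> * (real_of_int (g x y) - real c) \<le> - 1"
    and off: "\<And>y z. y \<in> F \<Longrightarrow> z \<in> F \<Longrightarrow> y \<noteq> z \<Longrightarrow> g y z \<le> int c"
  shows "card F \<le> 4 * k\<^sup>2"
proof -
  define K where "K y z = real_of_int (g y z) - real c + \<delta>" for y z
  define s where "s = real (card F)"
  \<comment> \<open>For \<open>a x = \<sigma> * t\<close> the leading terms of the form are at most \<open>2 * k * t\<^sup>2 - 2 * s * t\<close>; this \<open>t\<close> minimises them.\<close>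
  define a where "a z = (if z = x then \<sigma> * s / (2 * real k) else 1)" for z
  have fin: "finite F" using finite_sub F A by blast
  have k1: "1 \<le> real k" using k_pos by simp
  have "1 / (8 * real k) \<le> 1" using k1 by (simp add: divide_simps)
  hence \<delta>1: "\<delta> \<le> 1" using \<delta> by linarith
  have s0: "0 \<le> s" by (simp add: s_def)
  have FX: "y \<in> X" if "y \<in> F" for y using that F A by blast
  have xX: "x \<in> X" using x A by blast
  have "0 \<le> (\<Sum>y\<in>insert x F. \<Sum>z\<in>insert x F. a y * a z * K y z)"
    using A(2) x(1) F unfolding psd_shift_def K_def by blast
  also have "\<dots> = (a x)\<^sup>2 * K x x + 2 * a x * (\<Sum>y\<in>F. K x y) + (\<Sum>y\<in>F. \<Sum>z\<in>F. K y z)"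
  proof -
    have a1: "a y = 1" if "y \<in> F" for y using that x by (auto simp: a_def)
    have K: "K y x = K x y" if "y \<in> F" for y
      using g_commute[OF FX[OF that] xX] by (simp add: K_def)
    have "(\<Sum>y\<in>insert x F. \<Sum>z\<in>insert x F. a y * a z * K y z)
      = (a x)\<^sup>2 * K x x + (\<Sum>z\<in>F. a x * K x z) + ((\<Sum>y\<in>F. a x * K x y) + (\<Sum>y\<in>F. \<Sum>z\<in>F. K y z))"
      using fin x by (simp add: sum.distrib a1 K power2_eq_square)
    thus ?thesis by (simp add: sum_distrib_left mult.assoc)
  qed
  also have "(a x)\<^sup>2 * K x x \<le> (s\<^sup>2 / (4 * (real k)\<^sup>2)) * (2 * real k)"
  proof -
    have "(a x)\<^sup>2 = s\<^sup>2 / (4 * (real k)\<^sup>2)"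
      using \<sigma> by (auto simp: a_def power_divide power_mult_distrib)
    moreover have "K x x \<le> 2 * real k"
      using g_self[OF xX] \<delta>1 k1 by (simp add: K_def)
    moreover have "0 \<le> s\<^sup>2 / (4 * (real k)\<^sup>2)" by simp
    ultimately show ?thesis by (metis mult_left_mono)
  qed
  also have "(s\<^sup>2 / (4 * (real k)\<^sup>2)) * (2 * real k) = s\<^sup>2 / (2 * real k)"
    using k1 by (simp add: field_simps power2_eq_square)
  also have "2 * a x * (\<Sum>y\<in>F. K x y) \<le> s / real k * (s * (- 1 + \<delta>))"
  proof -
    have "\<sigma> * K x y \<le> - 1 + \<delta>" if "y \<in> F" for y
      using star[OF that] \<sigma> \<delta> by (auto simp: K_def algebra_simps)
    hence "(\<Sum>y\<in>F. \<sigma> * K x y) \<le> s * (- 1 + \<delta>)"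
      using sum_mono[of F "\<lambda>y. \<sigma> * K x y" "\<lambda>_. - 1 + \<delta>"] by (simp add: s_def)
    hence "s / real k * (\<Sum>y\<in>F. \<sigma> * K x y) \<le> s / real k * (s * (- 1 + \<delta>))"
      using s0 by (intro mult_left_mono) auto
    moreover have "2 * a x * (\<Sum>y\<in>F. K x y) = s / real k * (\<Sum>y\<in>F. \<sigma> * K x y)"
      by (simp add: a_def sum_distrib_left[symmetric])
    ultimately show ?thesis by simp
  qed
  also have "(\<Sum>y\<in>F. \<Sum>z\<in>F. K y z) \<le> s * real k + s\<^sup>2 * \<delta>"
  proof -
    have "(\<Sum>z\<in>F. K y z) \<le> (\<Sum>z\<in>F. (if z = y then real k else 0) + \<delta>)" if "y \<in> F" for y
      using off[OF that] g_self[OF FX[OF that]] by (intro sum_mono) (force simp: K_def)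
    hence "(\<Sum>z\<in>F. K y z) \<le> real k + s * \<delta>" if "y \<in> F" for y
      using that fin by (simp add: sum.distrib s_def)
    hence "(\<Sum>y\<in>F. \<Sum>z\<in>F. K y z) \<le> s * (real k + s * \<delta>)"
      using sum_mono[of F "\<lambda>y. \<Sum>z\<in>F. K y z" "\<lambda>_. real k + s * \<delta>"] by (simp add: s_def)
    thus ?thesis by (simp add: algebra_simps power2_eq_square)
  qed
  finally have "0 \<le> s\<^sup>2 / (2 * real k) + s / real k * (s * (- 1 + \<delta>)) + (s * real k + s\<^sup>2 * \<delta>)" by simp
  hence "0 \<le> real k * (s\<^sup>2 / (2 * real k) + s / real k * (s * (- 1 + \<delta>)) + (s * real k + s\<^sup>2 * \<delta>))"
    using k1 by (intro mult_nonneg_nonneg) auto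
  also have "\<dots> = s\<^sup>2 * (- 1 / 2 + \<delta> + real k * \<delta>) + s * (real k)\<^sup>2"
    using k1 by (simp add: field_simps power2_eq_square)
  also have "\<dots> \<le> s\<^sup>2 * (- 1 / 4) + s * (real k)\<^sup>2"
  proof -
    have "real k * \<delta> \<le> 1 / 8" using \<delta>(2) k1 by (simp add: field_simps)
    moreover have "\<delta> \<le> real k * \<delta>" using \<delta>(1) k1 mult_right_mono[of 1 "real k" \<delta>] by simp
    ultimately have "- 1 / 2 + \<delta> + real k * \<delta> \<le> - 1 / 4" by linarith
    thus ?thesis by (intro add_right_mono mult_left_mono) auto
  qed
  finally have "s * s \<le> s * (4 * (real k)\<^sup>2)" by (simp add: algebra_simps power2_eq_square)
  hence "s \<le> 4 * (real k)\<^sup>2" using s0 by (cases "s = 0") auto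
  hence "real (card F) \<le> real (4 * k\<^sup>2)" by (simp add: s_def)
  thus ?thesis by (simp only: of_nat_le_iff)
qed

text \<open>The affine functions \<open>x \<bullet> y - c\<close> form a diagonal system.\<close>

lemma card_equal_products:
  assumes F: "F \<subseteq> X" and eq: "\<And>x y. x \<in> F \<Longrightarrow> y \<in> F \<Longrightarrow> x \<noteq> y \<Longrightarrow> g x y = int c" and "c < k"
  shows "card F \<le> n + 1"
proof -
  define p where "p y i = (if i < n then v y i else 1)" for y i
  have lin: "(\<Sum>i<n. v x i * p y i) = real_of_int (g x y)" if "x \<in> F" "y \<in> F" for x y
    using that F g_ip[of x y] by (simp add: p_def ip_def subset_iff)
  have pn: "p y n = 1" for y by (simp add: p_def)
  have "finite F \<and> card F \<le> (1 + (n + 1) - 1) choose 1"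
  proof (rule card_le_of_triangular_forms
      [where f = "\<lambda>x y. (\<Sum>i<n. v x i * y i) - real c * y n" and p = p and \<rho> = "\<lambda>_. 0"])
    show "(\<lambda>y. (\<Sum>i<n. v x i * y i) - real c * y n) \<in> forms (n + 1) 1" for x
      by (intro forms_diff forms_linear forms_scale forms_coord) auto
    show "(\<Sum>i<n. v x i * p x i) - real c * p x n \<noteq> 0" if "x \<in> F" for x
      using that lin[of x x] F g_self[of x] assms(3) by (auto simp: pn)
    show "(\<Sum>i<n. v x i * p y i) - real c * p y n = 0" if "x \<in> F" "y \<in> F" "x \<noteq> y" for x y
      using that lin[of x y] eq[of x y] by (auto simp: pn)
  qed
  thus ?thesis by simp
qed

text \<open>When negative inner products do not occur, a product of only \<open>k\<close> linear factors separates the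
  vectors. This is where the exponent \<open>k\<close>, in place of \<open>2 * k - 1\<close>, comes from.\<close>

lemma card_nonneg_products:
  assumes F: "F \<subseteq> X" and nn: "\<And>x y. x \<in> F \<Longrightarrow> y \<in> F \<Longrightarrow> 0 \<le> g x y"
  shows "card F \<le> (n + k) choose k"
proof -
  define p where "p y i = (if i < n then v y i else 1)" for y i
  have lin: "(\<Sum>i<n. v x i * p y i) = real_of_int (g x y)" if "x \<in> F" "y \<in> F" for x y
    using that F g_ip[of x y] by (simp add: p_def ip_def subset_iff)
  have pn: "p y n = 1" for y by (simp add: p_def)
  define f where "f x y = (\<Prod>j<k. (\<Sum>i<n. v x i * y i) - real j * y n)" for x and y :: "nat \<Rightarrow> real"
  have "finite F \<and> card F \<le> (k + (n + 1) - 1) choose k"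
  proof (rule card_le_of_triangular_forms[where f = f and p = p and \<rho> = "\<lambda>_. 0"])
    show "f x \<in> forms (n + 1) k" for x
    proof -
      have "(\<lambda>y. (\<Sum>i<n. v x i * y i) - real j * y n) \<in> forms (n + 1) 1" for j
        by (intro forms_diff forms_linear forms_scale forms_coord) auto
      from forms_prod[of "{..<k}", OF _ this] show ?thesis by (simp add: f_def[abs_def])
    qed
    show "f x (p x) \<noteq> 0" if "x \<in> F" for x
      using that lin[of x x] F g_self[of x] by (auto simp: f_def pn)
    show "f x (p y) = 0" if "x \<in> F" "y \<in> F" "x \<noteq> y" for x y
    proof -
      have g0: "0 \<le> g x y" using that nn by blast
      have "g x y < int k" using that F by (intro g_less) auto
      hence "nat (g x y) \<in> {..<k}" using g0 by auto
      moreover have "(\<Sum>i<n. v x i * p y i) - real (nat (g x y)) * p y n = 0"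
        unfolding lin[OF that(1,2)] pn using g0 by simp
      ultimately have "\<exists>j\<in>{..<k}. (\<Sum>i<n. v x i * p y i) - real j * p y n = 0"
        by (rule bexI[rotated])
      thus ?thesis unfolding f_def by (intro prod_zero) simp_all
    qed
  qed
  thus ?thesis by (simp add: add.commute)
qed

text \<open>By \<open>star_bound\<close> the graph of the products below \<open>c\<close> has bounded degree, so a positive fraction
  of \<open>F\<close> has all products equal to \<open>c\<close>.\<close>

lemma card_nonpos_shift:
  assumes A: "A \<subseteq> X" "psd_shift c \<delta> A" and \<delta>: "0 \<le> \<delta>" "\<delta> \<le> 1 / (8 * real k)"
    and F: "F \<subseteq> A" and c: "c < k"
    and off: "\<And>y z. y \<in> F \<Longrightarrow> z \<in> F \<Longrightarrow> y \<noteq> z \<Longrightarrow> g y z \<le> int c"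
  shows "card F \<le> (4 * k\<^sup>2 + 1) * (n + 1)"
proof -
  have FX: "F \<subseteq> X" using F A by blast
  have fin: "finite F" using finite_sub FX by blast
  have "\<exists>I\<subseteq>F. (\<forall>x\<in>I. \<forall>y\<in>I. x \<noteq> y \<longrightarrow> \<not> g x y < int c) \<and> (\<forall>y\<in>F - I. \<exists>x\<in>I. g x y < int c)"
  proof (rule ex_dominating_independent[OF fin])
    show "g y x < int c" if "x \<in> F" "y \<in> F" "g x y < int c" for x y
      using that g_commute[OF subsetD[OF FX that(1)] subsetD[OF FX that(2)]] by simp
  qed
  then obtain I where I: "I \<subseteq> F" "\<And>x y. x \<in> I \<Longrightarrow> y \<in> I \<Longrightarrow> x \<noteq> y \<Longrightarrow> \<not> g x y < int c"
    and dom: "\<And>y. y \<in> F - I \<Longrightarrow> \<exists>x\<in>I. g x y < int c"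
    by blast
  have finI: "finite I" using I(1) fin finite_subset by blast
  have "card I \<le> n + 1"
    by (rule card_equal_products[of _ c]) (use I off c FX in force)+
  have neg: "card {y\<in>F. y \<noteq> x \<and> g x y < int c} \<le> 4 * k\<^sup>2" if "x \<in> I" for x
  proof (rule star_bound[OF A \<delta>, where \<sigma> = 1 and x = x])
    show "1 * (real_of_int (g x y) - real c) \<le> - 1" if "y \<in> {y\<in>F. y \<noteq> x \<and> g x y < int c}" for y
    proof -
      have "g x y + 1 \<le> int c" using that by simp
      hence "real_of_int (g x y + 1) \<le> real_of_int (int c)" by (simp only: of_int_le_iff)
      thus ?thesis by simp
    qed
  qed (use that I(1) F off in auto)
  have "F \<subseteq> (\<Union>x\<in>I. insert x {y\<in>F. y \<noteq> x \<and> g x y < int c})"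
    using dom by blast
  hence "card F \<le> card (\<Union>x\<in>I. insert x {y\<in>F. y \<noteq> x \<and> g x y < int c})"
    using fin finI by (intro card_mono) auto
  also have "\<dots> \<le> (\<Sum>x\<in>I. card (insert x {y\<in>F. y \<noteq> x \<and> g x y < int c}))"
    by (rule card_UN_le[OF finI])
  also have "\<dots> \<le> (\<Sum>x\<in>I. 4 * k\<^sup>2 + 1)"
    using neg fin by (intro sum_mono) (auto simp: card_insert_if)
  also have "\<dots> = card I * (4 * k\<^sup>2 + 1)" by simp
  also have "\<dots> \<le> (n + 1) * (4 * k\<^sup>2 + 1)"
    using \<open>card I \<le> n + 1\<close> by (rule mult_right_mono) simp
  finally show ?thesis by (simp only: mult.commute)
qed

text \<open>This is the usual proof of Ramsey's theorem. The point of repeating it is the set \<open>A'\<close>, a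
  positive fraction of \<open>A\<close>, all of whose elements see a chosen vertex \<open>y\<close> in the same colour
  \<open>\<beta> y\<close>.\<close>

lemma ramsey_sequence:
  assumes "A \<subseteq> X" "(2 * k + 2) ^ s * M \<le> card A" "0 < M"
  shows "\<exists>Y \<beta> A'. Y \<subseteq> A \<and> card Y = s \<and> A' \<subseteq> A \<and> M \<le> card A' \<and> \<beta> ` Y \<subseteq> {- int k..<int k} \<and>
           (\<forall>y\<in>Y. \<forall>z\<in>A'. g y z = \<beta> y) \<and> (\<forall>y\<in>Y. \<forall>z\<in>Y. y \<noteq> z \<longrightarrow> g y z = \<beta> y \<or> g y z = \<beta> z)"
  using assms
proof (induction s arbitrary: A)
  case 0
  thus ?case by (intro exI[of _ "{}"] exI[of _ "\<lambda>_. 0"] exI[of _ A]) auto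
next
  case (Suc s)
  \<comment> \<open>There are \<open>2 * k\<close> colours; the base \<open>2 * k + 2\<close> makes up for the removal of \<open>y\<close>.\<close>
  define P where "P = (2 * k + 2) ^ s * M"
  have P: "0 < P" "(2 * k + 2) * P \<le> card A" using Suc.prems by (auto simp: P_def algebra_simps)
  hence "0 < card A" using k_pos by (metis add_gr_0 less_le_trans mult_pos_pos zero_less_numeral)
  then obtain y where y: "y \<in> A" by (metis card.empty ex_in_conv less_irrefl)
  have fin: "finite A" using Suc.prems finite_sub by blast
  have yX: "y \<in> X" using y Suc.prems by blast
  have "g y ` (A - {y}) \<subseteq> {- int k..<int k}"
    using g_lower g_less yX Suc.prems(1) by (auto simp: subset_iff)
  moreover have "card {- int k..<int k} * (P - 1) < card (A - {y})"
  proof -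
    have "card {- int k..<int k} = 2 * k" by simp
    hence "card {- int k..<int k} * (P - 1) = 2 * k * (P - 1)" by simp
    moreover have "2 * k * (P - 1) + 2 * k = 2 * k * P"
      using P(1) by (metis Suc_diff_1 mult_Suc_right add.commute)
    moreover have "(2 * k + 2) * P = 2 * k * P + 2 * P" by (simp add: algebra_simps)
    moreover have "card (A - {y}) + 1 = card A" using y fin \<open>0 < card A\<close> by simp
    ultimately show ?thesis using P k_pos by linarith
  qed
  ultimately obtain b where b: "b \<in> {- int k..<int k}" "P - 1 < card {z\<in>A - {y}. g y z = b}"
    using ex_large_fibre[of "A - {y}" "g y" "{- int k..<int k}" "P - 1"] fin by auto
  define B where "B = {z\<in>A - {y}. g y z = b}"
  have B: "B \<subseteq> X" "B \<subseteq> A" "y \<notin> B" using Suc.prems by (auto simp: B_def)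
  have "(2 * k + 2) ^ s * M \<le> card B" using b(2) by (simp add: B_def P_def)
  from Suc.IH[OF B(1) this Suc.prems(3)]
  obtain Y \<beta> A' where Y: "Y \<subseteq> B" "card Y = s" "A' \<subseteq> B" "M \<le> card A'" "\<beta> ` Y \<subseteq> {- int k..<int k}"
    "\<forall>y\<in>Y. \<forall>z\<in>A'. g y z = \<beta> y" "\<forall>y\<in>Y. \<forall>z\<in>Y. y \<noteq> z \<longrightarrow> g y z = \<beta> y \<or> g y z = \<beta> z"
    by blast
  have yY: "y \<notin> Y" using Y(1) B(3) by blast
  have gy: "g y z = b" if "z \<in> B" for z using that by (simp add: B_def)
  have gy': "g z y = b" if "z \<in> B" for z
    using gy[OF that] g_commute[of z y] that B(1) yX by auto
  have "finite Y" using Y(1) B(1) finite_sub by blast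
  show ?case
  proof (intro exI conjI)
    show "insert y Y \<subseteq> A" "A' \<subseteq> A" "M \<le> card A'" using y Y B by auto
    show "card (insert y Y) = Suc s" using yY \<open>finite Y\<close> Y(2) by simp
    show "(\<beta>(y := b)) ` insert y Y \<subseteq> {- int k..<int k}" using Y(5) b(1) yY by auto
    show "\<forall>z\<in>insert y Y. \<forall>w\<in>A'. g z w = (\<beta>(y := b)) z"
      using Y(3,6) gy yY by (auto simp: subset_iff)
    show "\<forall>z\<in>insert y Y. \<forall>w\<in>insert y Y. z \<noteq> w \<longrightarrow> g z w = (\<beta>(y := b)) z \<or> g z w = (\<beta>(y := b)) w"
      using Y(1,7) gy gy' yY by (auto simp: subset_iff)
  qed
qed

definition clique :: "nat \<Rightarrow> 'a set \<Rightarrow> bool" where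
  "clique b Q \<longleftrightarrow> Q \<subseteq> X \<and> card Q = T \<and> (\<forall>x\<in>Q. \<forall>y\<in>Q. x \<noteq> y \<longrightarrow> g x y = int b)"

definition attached :: "nat \<Rightarrow> 'a set \<Rightarrow> 'a set \<Rightarrow> bool" where
  "attached b Q A \<longleftrightarrow> (\<forall>q\<in>Q. \<forall>y\<in>A. g q y = int b)"

definition centre :: "'a set \<Rightarrow> nat \<Rightarrow> real" where
  "centre Q i = (\<Sum>q\<in>Q. v q i) / real T"

lemma ip_centre_right: "ip n w (centre Q) = (\<Sum>q\<in>Q. ip n w (v q)) / real T"
proof -
  have "centre Q = (\<lambda>i. (1 / real T) * (\<Sum>q\<in>Q. v q i))" by (simp add: centre_def fun_eq_iff)
  thus ?thesis by (simp only: ip_scale_right ip_sum_right) simp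
qed

lemma ip_centre_left: "ip n (centre Q) w = (\<Sum>q\<in>Q. ip n (v q) w) / real T"
  by (simp add: ip_commute[of n "centre Q"] ip_centre_right ip_commute[of n w])

lemma ip_centre_attached:
  assumes "clique c Q" "attached b Q A" "y \<in> A" "A \<subseteq> X"
  shows "ip n (centre Q) (v y) = real b"
proof -
  have "(\<Sum>q\<in>Q. ip n (v q) (v y)) = (\<Sum>q\<in>Q. real b)"
    using assms by (intro sum.cong) (auto simp: clique_def attached_def subset_iff simp flip: g_ip)
  thus ?thesis using assms(1) T_pos by (simp add: ip_centre_left clique_def)
qed

lemma ip_centre_member:
  assumes "clique b Q" "q \<in> Q"
  shows "ip n (centre Q) (v q) = real b + (real k - real b) / real T"
proof -
  have fin: "finite Q" and QX: "\<And>q. q \<in> Q \<Longrightarrow> q \<in> X" and card: "card Q = T"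
    using assms(1) finite_sub by (auto simp: clique_def)
  have "(\<Sum>p\<in>Q. ip n (v p) (v q)) = (\<Sum>p\<in>Q. real b + (if p = q then real k - real b else 0))"
    using assms g_self[OF QX[OF assms(2)]]
    by (intro sum.cong) (auto simp: clique_def subset_iff simp flip: g_ip)
  also have "\<dots> = real T * real b + (real k - real b)"
    using fin assms(2) card by (simp add: sum.distrib)
  finally show ?thesis using T_pos by (simp add: ip_centre_left field_simps)
qed

lemma ip_centre_self:
  assumes "clique b Q"
  shows "ip n (centre Q) (centre Q) = real b + (real k - real b) / real T"
proof -
  have "(\<Sum>q\<in>Q. ip n (centre Q) (v q)) = (\<Sum>q\<in>Q. real b + (real k - real b) / real T)"
    using assms by (intro sum.cong) (auto simp: ip_centre_member)
  thus ?thesis using assms T_pos unfolding ip_centre_right by (simp add: clique_def)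
qed

text \<open>Take the centre of the clique as the vector \<open>u\<close>; its squared norm exceeds \<open>b\<close> by
  \<open>(k - b) / T\<close>.\<close>

lemma psd_shift_of_clique:
  assumes Q: "clique b Q" "attached b Q A" and A: "A \<subseteq> X"
  shows "psd_shift b ((real k - real b) / real T) A"
  unfolding psd_shift_def
proof (intro allI impI)
  fix F :: "'a set" and a :: "'a \<Rightarrow> real"
  assume F: "F \<subseteq> A"
  define w where "w x i = v x i - centre Q i" for x i
  have "ip n (w x) (w y) = real_of_int (g x y) - real b + (real k - real b) / real T"
    if "x \<in> F" "y \<in> F" for x y
  proof -
    have xy: "x \<in> A" "y \<in> A" "x \<in> X" "y \<in> X" using that F A by auto
    have "w x = (\<lambda>i. v x i - centre Q i)" for x by (simp add: w_def fun_eq_iff)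
    hence "ip n (w x) (w y) = ip n (v x) (v y) - ip n (centre Q) (v x) - ip n (centre Q) (v y)
        + ip n (centre Q) (centre Q)"
      by (simp add: ip_diff_left ip_diff_right ip_commute[of n "v x" "centre Q"])
    thus ?thesis
      using ip_centre_attached[OF Q _ A] ip_centre_self[OF Q(1)] xy by (simp add: g_ip)
  qed
  hence "(\<Sum>x\<in>F. \<Sum>y\<in>F. a x * a y * (real_of_int (g x y) - real b + (real k - real b) / real T)) =
      ip n (\<lambda>i. \<Sum>x\<in>F. a x * w x i) (\<lambda>i. \<Sum>x\<in>F. a x * w x i)"
    unfolding ip_comb by (intro sum.cong refl) simp
  thus "0 \<le> (\<Sum>x\<in>F. \<Sum>y\<in>F. a x * a y * (real_of_int (g x y) - real b + (real k - real b) / real T))"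
    by (simp add: ip_self_nonneg)
qed

lemma clique_shift_small:
  assumes "b < k"
  shows "0 \<le> (real k - real b) / real T" "(real k - real b) / real T \<le> 1 / (8 * real k)"
proof -
  have "real (8 * k\<^sup>2) \<le> real T" using T_large by (simp only: of_nat_le_iff less_imp_le)
  hence "8 * real k * (real k - real b) \<le> real T"
    using mult_left_mono[of "real k - real b" "real k" "8 * real k"]
    by (simp add: power2_eq_square)
  thus "(real k - real b) / real T \<le> 1 / (8 * real k)"
    using T_pos k_pos by (simp add: field_simps)
  show "0 \<le> (real k - real b) / real T" using assms by simp
qed

text \<open>Among the vertices of a Ramsey sequence, the most popular colour \<open>b\<close> gives a clique, and the
  set left over at the end is attached to that clique with the same value \<open>b\<close>.\<close>

lemma ex_attached_clique:
  assumes A: "A \<subseteq> X" "ramsey_bound k * M \<le> card A" "0 < M"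
  shows "\<exists>b Q A'. b \<in> {- int k..<int k} \<and> Q \<subseteq> A \<and> card Q = T \<and> A' \<subseteq> A \<and> M \<le> card A' \<and>
      (\<forall>x\<in>Q. \<forall>y\<in>Q. x \<noteq> y \<longrightarrow> g x y = b) \<and> (\<forall>q\<in>Q. \<forall>y\<in>A'. g q y = b)"
proof -
  obtain Y \<beta> A' where Y: "Y \<subseteq> A" "card Y = 2 * k * T" "A' \<subseteq> A" "M \<le> card A'"
    "\<beta> ` Y \<subseteq> {- int k..<int k}" "\<forall>y\<in>Y. \<forall>z\<in>A'. g y z = \<beta> y"
    "\<forall>y\<in>Y. \<forall>z\<in>Y. y \<noteq> z \<longrightarrow> g y z = \<beta> y \<or> g y z = \<beta> z"
    using ramsey_sequence[OF A(1) _ A(3), of "2 * k * T"] A(2) unfolding ramsey_bound_def by blast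
  have "card {- int k..<int k} * (T - 1) < card Y"
    using Y(2) T_pos k_pos by (simp add: nat_mult_distrib)
  then obtain b where b: "b \<in> {- int k..<int k}" "T - 1 < card {y\<in>Y. \<beta> y = b}"
    using ex_large_fibre[of Y \<beta> "{- int k..<int k}" "T - 1"] Y(1,5) A(1) finite_sub by auto
  then obtain Q where Q: "Q \<subseteq> {y\<in>Y. \<beta> y = b}" "card Q = T"
    using obtain_subset_with_card_n[of T "{y\<in>Y. \<beta> y = b}"] by (metis Suc_diff_1 Suc_leI T_pos)
  show ?thesis
  proof (intro exI conjI)
    show "b \<in> {- int k..<int k}" "Q \<subseteq> A" "card Q = T" "A' \<subseteq> A" "M \<le> card A'"
      using b(1) Q Y(1,3,4) by blast+
    show "\<forall>x\<in>Q. \<forall>y\<in>Q. x \<noteq> y \<longrightarrow> g x y = b"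
    proof (intro ballI impI)
      fix x y assume "x \<in> Q" "y \<in> Q" "x \<noteq> y"
      moreover from this have "x \<in> Y" "y \<in> Y" "\<beta> x = b" "\<beta> y = b" using Q(1) by auto
      ultimately show "g x y = b" using Y(7) by metis
    qed
    show "\<forall>q\<in>Q. \<forall>y\<in>A'. g q y = b"
    proof (intro ballI)
      fix q y assume "q \<in> Q" "y \<in> A'"
      moreover from this have "q \<in> Y" "\<beta> q = b" using Q(1) by auto
      ultimately show "g q y = b" using Y(6) by metis
    qed
  qed
qed

lemma ex_maximiser_on_finite:
  assumes "finite F" "F \<noteq> {}"
  shows "\<exists>x\<in>F. \<forall>z\<in>F. f z \<le> (f x :: nat)"
proof -
  have "Max (f ` F) \<in> f ` F" using assms by (intro Max_in) auto
  then obtain x where "x \<in> F" "Max (f ` F) = f x" by auto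
  moreover have "\<forall>z\<in>F. f z \<le> Max (f ` F)" using assms(1) by simp
  ultimately show ?thesis by metis
qed

text \<open>One step of the descent. A maximal subset \<open>F\<close> without products above \<open>c\<close> has linear size by
  \<open>card_nonpos_shift\<close>, and every other vector has a product above \<open>c\<close> with a member of \<open>F\<close>. So
  some \<open>x\<close> has such a product with a fraction of order \<open>1 / n\<close> of \<open>A\<close>, unless \<open>A\<close> itself has
  linear size. In that
  neighbourhood there is a large clique with attached vectors, and its value exceeds \<open>c\<close>: otherwise
  \<open>star_bound\<close>, applied to \<open>x\<close> and the clique, would bound the size of the clique. Each step costs a
  factor of order \<open>n\<close> and raises the value \<open>c\<close>, which stays below \<open>k\<close>.\<close>

lemma descent:
  assumes A: "A \<subseteq> X" "psd_shift c \<delta> A" and \<delta>: "0 \<le> \<delta>" "\<delta> \<le> 1 / (8 * real k)" and c: "c < k"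
  shows "card A \<le> descent_factor k * n \<or>
    (\<exists>b Q A'. c < b \<and> b < k \<and> clique b Q \<and> Q \<subseteq> A \<and> A' \<subseteq> A \<and> attached b Q A' \<and>
       card A \<le> descent_factor k * n * card A')"
proof -
  have fin: "finite A" using A finite_sub by blast
  have "\<exists>F\<subseteq>A. (\<forall>x\<in>F. \<forall>y\<in>F. x \<noteq> y \<longrightarrow> \<not> int c < g x y) \<and> (\<forall>y\<in>A - F. \<exists>x\<in>F. int c < g x y)"
  proof (rule ex_dominating_independent[OF fin])
    show "int c < g y x" if "x \<in> A" "y \<in> A" "int c < g x y" for x y
      using that g_commute[OF subsetD[OF A(1) that(1)] subsetD[OF A(1) that(2)]] by simp
  qed
  then obtain F where F: "F \<subseteq> A" and F_off: "\<And>x y. x \<in> F \<Longrightarrow> y \<in> F \<Longrightarrow> x \<noteq> y \<Longrightarrow> \<not> int c < g x y"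
    and dom: "\<And>y. y \<in> A - F \<Longrightarrow> \<exists>x\<in>F. int c < g x y"
    by blast
  have finF: "finite F" using F fin finite_subset by blast
  have "card F \<le> (4 * k\<^sup>2 + 1) * (n + 1)"
    using card_nonpos_shift[OF A \<delta> F c] F_off by force
  also have "\<dots> \<le> (4 * k\<^sup>2 + 1) * (2 * n)" using n_pos by (intro mult_left_mono) auto
  finally have cardF: "card F \<le> 2 * (4 * k\<^sup>2 + 1) * n" by simp
  define N where "N x = {y\<in>A. y \<noteq> x \<and> int c < g x y}" for x
  show ?thesis
  proof (cases "F = {}")
    case True
    hence "A = {}" using dom by blast
    thus ?thesis by simp
  next
    case False
    obtain x where x: "x \<in> F" and max: "\<And>z. z \<in> F \<Longrightarrow> card (N z) \<le> card (N x)"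
      using ex_maximiser_on_finite[OF finF False, of "\<lambda>z. card (N z)"] by blast
    have NA: "N x \<subseteq> A" by (auto simp: N_def)
    have "A \<subseteq> (\<Union>z\<in>F. insert z (N z))" using dom by (auto simp: N_def)
    hence "card A \<le> card (\<Union>z\<in>F. insert z (N z))"
      using fin finF by (intro card_mono) (auto simp: N_def)
    also have "\<dots> \<le> (\<Sum>z\<in>F. card (insert z (N z)))" by (rule card_UN_le[OF finF])
    also have "\<dots> \<le> (\<Sum>z\<in>F. 1 + card (N x))"
      using max fin by (intro sum_mono) (auto simp: N_def card_insert_if)
    also have "\<dots> = card F * (1 + card (N x))" by simp
    also have "\<dots> \<le> 2 * (4 * k\<^sup>2 + 1) * n * (1 + card (N x))"
      using cardF by (rule mult_right_mono) simp
    finally have cardA: "card A \<le> 2 * (4 * k\<^sup>2 + 1) * n * (1 + card (N x))" .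
    define M where "M = card (N x) div ramsey_bound k"
    have R: "0 < ramsey_bound k" by (simp add: ramsey_bound_def)
    have NM: "card (N x) \<le> ramsey_bound k * (M + 1)"
      using R by (simp add: M_def) (metis dividend_less_times_div less_imp_le mult.commute)
    show ?thesis
    proof (cases "M = 0")
      case True
      hence "1 + card (N x) \<le> 1 + 2 * ramsey_bound k" using NM by simp
      hence "2 * (4 * k\<^sup>2 + 1) * n * (1 + card (N x)) \<le> 2 * (4 * k\<^sup>2 + 1) * n * (1 + 2 * ramsey_bound k)"
        by (rule mult_left_mono) simp
      thus ?thesis using cardA by (simp add: descent_factor_def algebra_simps)
    next
      case False
      have RM: "ramsey_bound k * M \<le> card (N x)" by (simp add: M_def)
      have "0 < M" using False by simp
      obtain b Q A' where Q: "b \<in> {- int k..<int k}" "Q \<subseteq> N x" "card Q = T" "A' \<subseteq> N x" "M \<le> card A'"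
        "\<forall>x\<in>Q. \<forall>y\<in>Q. x \<noteq> y \<longrightarrow> g x y = b" "\<forall>q\<in>Q. \<forall>y\<in>A'. g q y = b"
        using ex_attached_clique[OF subset_trans[OF NA A(1)] RM \<open>0 < M\<close>] by blast
      have "int c < b"
      proof (rule ccontr)
        assume *: "\<not> int c < b"
        have "card Q \<le> 4 * k\<^sup>2"
        proof (rule star_bound[OF A \<delta>, where \<sigma> = "-1" and x = x])
          show "x \<in> A" "x \<notin> Q" "Q \<subseteq> A" using x F Q(2) NA by (auto simp: N_def)
          show "- 1 * (real_of_int (g x y) - real c) \<le> - 1" if "y \<in> Q" for y
          proof -
            have "int c + 1 \<le> g x y" using that Q(2) by (auto simp: N_def)
            hence "real_of_int (int c + 1) \<le> real_of_int (g x y)" by (simp only: of_int_le_iff)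
            thus ?thesis by simp
          qed
          show "g y z \<le> int c" if "y \<in> Q" "z \<in> Q" "y \<noteq> z" for y z
            using that Q(6) * by auto
        qed simp
        thus False using Q(3) T_large by simp
      qed
      hence b: "int (nat b) = b" "c < nat b" "nat b < k" using Q(1) by auto
      have "1 + card (N x) \<le> (1 + 2 * ramsey_bound k) * card A'"
      proof -
        have "1 \<le> card A'" using False Q(5) by simp
        moreover have "ramsey_bound k * (M + 1) \<le> ramsey_bound k * (2 * card A')"
          using Q(5) \<open>1 \<le> card A'\<close> by (intro mult_left_mono) auto
        moreover have "(1 + 2 * ramsey_bound k) * card A' = card A' + ramsey_bound k * (2 * card A')"
          by (simp add: algebra_simps)
        ultimately show ?thesis using NM by linarith
      qed
      hence "2 * (4 * k\<^sup>2 + 1) * n * (1 + card (N x))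
          \<le> 2 * (4 * k\<^sup>2 + 1) * n * ((1 + 2 * ramsey_bound k) * card A')"
        by (rule mult_left_mono) simp
      hence "card A \<le> descent_factor k * n * card A'"
        using cardA by (simp add: descent_factor_def algebra_simps)
      moreover have "clique (nat b) Q" "attached (nat b) Q A'" "Q \<subseteq> A" "A' \<subseteq> A"
        using Q b NA A(1) by (auto simp: clique_def attached_def)
      ultimately show ?thesis using b by blast
    qed
  qed
qed

lemma card_psd_shift_le:
  assumes "A \<subseteq> X" "psd_shift c \<delta> A" "0 \<le> \<delta>" "\<delta> \<le> 1 / (8 * real k)" "c < k"
  shows "card A \<le> (descent_factor k * n) ^ (k - c)"
  using assms
proof (induction "k - c" arbitrary: c \<delta> A rule: less_induct)
  case less
  have D: "1 \<le> descent_factor k * n" using n_pos by (simp add: descent_factor_def)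
  from descent[OF less.prems] show ?case
  proof (elim disjE exE conjE)
    assume "card A \<le> descent_factor k * n"
    also have "\<dots> \<le> (descent_factor k * n) ^ (k - c)"
      using power_increasing[OF _ D, of 1 "k - c"] less.prems(5) by simp
    finally show ?thesis .
  next
    fix b Q A'
    assume b: "c < b" "b < k" "clique b Q" "A' \<subseteq> A" "attached b Q A'"
      and le: "card A \<le> descent_factor k * n * card A'"
    have "A' \<subseteq> X" using b less.prems by blast
    have "card A' \<le> (descent_factor k * n) ^ (k - b)"
      by (rule less.hyps[OF _ \<open>A' \<subseteq> X\<close> psd_shift_of_clique[OF b(3,5) \<open>A' \<subseteq> X\<close>]])
        (use b clique_shift_small[OF b(2)] in auto)
    also have "\<dots> \<le> (descent_factor k * n) ^ (k - c - 1)"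
      using D b by (intro power_increasing) auto
    finally have "descent_factor k * n * card A' \<le> (descent_factor k * n) ^ Suc (k - c - 1)"
      by (metis mult_le_mono2 power_Suc)
    thus ?thesis using le less.prems(5) by (simp add: Suc_diff_Suc)
  qed
qed

text \<open>In the model case of the vectors \<open>e\<^sub>1 + \<dots> + e\<^sub>k\<close> in \<open>\<int>\<^sup>n\<close>, the clique \<open>Q i\<close> may consist of vectors that share
  \<open>e\<^sub>1 + \<dots> + e\<^sub>i\<close> and have no other coordinate in common.\<close>

definition chain :: "nat \<Rightarrow> (nat \<Rightarrow> 'a set) \<Rightarrow> bool" where
  "chain m Q \<longleftrightarrow> (\<forall>i\<in>{1..m}. clique i (Q i)) \<and> (\<forall>i\<in>{1..m}. \<forall>j\<in>{i<..m}. attached i (Q i) (Q j))"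

definition chain_attached :: "nat \<Rightarrow> (nat \<Rightarrow> 'a set) \<Rightarrow> 'a set \<Rightarrow> bool" where
  "chain_attached m Q A \<longleftrightarrow> chain m Q \<and> (\<forall>i\<in>{1..m}. attached i (Q i) A)"

definition chained :: "'a \<Rightarrow> bool" where
  "chained x \<longleftrightarrow> (\<exists>Q. chain_attached (k - 1) Q {x})"

lemma chain_attached_mono: "chain_attached m Q A \<Longrightarrow> B \<subseteq> A \<Longrightarrow> chain_attached m Q B"
  unfolding chain_attached_def attached_def by blast

lemma chain_attached_extend:
  assumes "chain_attached c Q A" "clique (Suc c) P" "P \<subseteq> A" "A' \<subseteq> A" "attached (Suc c) P A'"
  shows "chain_attached (Suc c) (Q(Suc c := P)) A'"
proof -
  let ?Q = "Q(Suc c := P)"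
  have old: "?Q i = Q i" if "i \<le> c" for i using that by simp
  have sub: "attached i (Q i) B" if "i \<in> {1..c}" "B \<subseteq> A" for i B
    using assms(1) that unfolding chain_attached_def attached_def by blast
  have "clique i (?Q i)" if "i \<in> {1..Suc c}" for i
    using that assms(1,2) by (cases "i = Suc c") (auto simp: chain_attached_def chain_def)
  moreover have "attached i (?Q i) (?Q j)" if "i \<in> {1..Suc c}" "j \<in> {i<..Suc c}" for i j
  proof (cases "j = Suc c")
    case True
    thus ?thesis using that sub[OF _ assms(3), of i] by simp
  next
    case False
    hence "i \<in> {1..c}" "j \<in> {i<..c}" using that by auto
    thus ?thesis using assms(1) by (simp add: chain_attached_def chain_def)
  qed
  moreover have "attached i (?Q i) A'" if "i \<in> {1..Suc c}" for i
    using that assms(5) sub[OF _ assms(4), of i] by (cases "i = Suc c") auto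
  ultimately show ?thesis unfolding chain_attached_def chain_def by blast
qed

text \<open>A descent that never skips a value produces a chain, and thus a chained vector. Every skipped
  value saves a factor of order \<open>n\<close> compared with \<open>card_psd_shift_le\<close>.\<close>

lemma card_unchained_le:
  assumes "A \<subseteq> X" "psd_shift c \<delta> A" "0 \<le> \<delta>" "\<delta> \<le> 1 / (8 * real k)" "c < k"
    and "chain_attached c Q A" "\<And>x. x \<in> A \<Longrightarrow> \<not> chained x"
  shows "card A \<le> (descent_factor k * n) ^ (k - c - 1)"
  using assms
proof (induction "k - c" arbitrary: c \<delta> A Q rule: less_induct)
  case less
  have D: "1 \<le> descent_factor k * n" using n_pos by (simp add: descent_factor_def)
  show ?case
  proof (cases "c = k - 1")
    case True
    have "A = {}"
    proof (rule ccontr)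
      assume "A \<noteq> {}"
      then obtain x where "x \<in> A" by blast
      thus False using less.prems(6,7) chain_attached_mono[of "k - 1" Q A "{x}"] True
        unfolding chained_def by blast
    qed
    thus ?thesis by simp
  next
    case False
    hence c: "Suc c < k" using less.prems(5) by linarith
    from descent[OF less.prems(1-5)] show ?thesis
    proof (elim disjE exE conjE)
      assume "card A \<le> descent_factor k * n"
      also have "\<dots> \<le> (descent_factor k * n) ^ (k - c - 1)"
        using power_increasing[OF _ D, of 1 "k - c - 1"] c by simp
      finally show ?thesis .
    next
      fix b P A'
      assume b: "c < b" "b < k" "clique b P" "P \<subseteq> A" "A' \<subseteq> A" "attached b P A'"
        and le: "card A \<le> descent_factor k * n * card A'"
      have A'X: "A' \<subseteq> X" using b less.prems by blast
      note psd = psd_shift_of_clique[OF b(3,6) A'X] clique_shift_small[OF b(2)]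
      have "card A' \<le> (descent_factor k * n) ^ (k - c - 2)"
      proof (cases "b = Suc c")
        case True
        have "card A' \<le> (descent_factor k * n) ^ (k - b - 1)"
        proof (rule less.hyps[OF _ A'X psd b(2)])
          show "k - b < k - c" using b by linarith
          show "chain_attached b (Q(Suc c := P)) A'"
            using chain_attached_extend[OF less.prems(6)] b True by blast
          show "\<not> chained x" if "x \<in> A'" for x using that b less.prems by blast
        qed
        thus ?thesis using True by (simp add: numeral_2_eq_2)
      next
        case False
        have "card A' \<le> (descent_factor k * n) ^ (k - b)"
          by (rule card_psd_shift_le[OF A'X psd b(2)])
        also have "\<dots> \<le> (descent_factor k * n) ^ (k - c - 2)"
          using D b False by (intro power_increasing) auto
        finally show ?thesis .
      qed
      hence "descent_factor k * n * card A' \<le> (descent_factor k * n) ^ Suc (k - c - 2)"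
        by (metis mult_le_mono2 power_Suc)
      moreover have "Suc (k - c - 2) = k - c - 1" using c by linarith
      ultimately show ?thesis using le by (metis order_trans)
    qed
  qed
qed

lemma card_all_unchained_le:
  assumes "A \<subseteq> X" "\<And>x. x \<in> A \<Longrightarrow> \<not> chained x"
  shows "card A \<le> (descent_factor k * n) ^ (k - 1)"
  using card_unchained_le[OF assms(1) psd_shift_zero[OF assms(1)], of "\<lambda>_. {}"] assms(2) k_pos
  by (simp add: chain_attached_def chain_def)

end

section \<open>Choosing signs\<close>

lemma card_sign_patterns:
  assumes V: "finite V" and AN: "A \<subseteq> V" "N \<subseteq> V" "A \<inter> N = {}" and k: "card (A \<union> N) \<le> k"
  shows "2 ^ card V \<le> 2 ^ k * card {P\<in>Pow V. A \<subseteq> P \<and> N \<inter> P = {}}"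
proof -
  have AV: "A \<union> N \<subseteq> V" using AN by blast
  have "inj_on (\<lambda>P. A \<union> P) (Pow (V - (A \<union> N)))"
    by (rule inj_onI) blast
  hence "2 ^ card (V - (A \<union> N)) = card ((\<lambda>P. A \<union> P) ` Pow (V - (A \<union> N)))"
    using V by (simp add: card_image card_Pow)
  also have "\<dots> \<le> card {P\<in>Pow V. A \<subseteq> P \<and> N \<inter> P = {}}"
    using V AN by (intro card_mono) auto
  finally have le: "2 ^ card (V - (A \<union> N)) \<le> card {P\<in>Pow V. A \<subseteq> P \<and> N \<inter> P = {}}" .
  have "card V = card (A \<union> N) + card (V - (A \<union> N))"
    using V AV by (metis card_Diff_subset card_mono finite_subset le_add_diff_inverse)
  hence "(2::nat) ^ card V = 2 ^ card (A \<union> N) * 2 ^ card (V - (A \<union> N))"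
    by (simp add: power_add)
  also have "\<dots> \<le> 2 ^ k * card {P\<in>Pow V. A \<subseteq> P \<and> N \<inter> P = {}}"
    using k le by (intro mult_mono power_increasing) auto
  finally show ?thesis .
qed

text \<open>Here \<open>r\<close> says of two unit vectors, belonging to \<open>x\<close> and \<open>y\<close>, whether they are nearly equal (\<open>1\<close>),
  nearly opposite (\<open>-1\<close>) or nearly orthogonal (\<open>0\<close>). Choose one vector in each class up to sign, and
  give it a random sign. Each \<open>x\<close> has \<open>k\<close> vectors in distinct classes, so all of them agree with the
  chosen signs with probability at least \<open>2 ^ (- k)\<close>; two such \<open>x\<close>, \<open>y\<close> have no nearly opposite vectors.
  The average is taken over the subsets \<open>P\<close> of representatives with positive sign.\<close>

lemma ex_sign_consistent_subset:
  fixes r :: "'a \<times> nat \<Rightarrow> 'a \<times> nat \<Rightarrow> int" and Y :: "'a set" and k :: nat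
  defines "J \<equiv> Y \<times> {..<k}"
  assumes Y: "finite Y"
    and r_vals: "\<And>p q. p \<in> J \<Longrightarrow> q \<in> J \<Longrightarrow> r p q \<in> {-1, 0, 1}"
    and r_sym: "\<And>p q. p \<in> J \<Longrightarrow> q \<in> J \<Longrightarrow> r p q = r q p"
    and r_refl: "\<And>p. p \<in> J \<Longrightarrow> r p p = 1"
    and r_trans: "\<And>p q s. p \<in> J \<Longrightarrow> q \<in> J \<Longrightarrow> s \<in> J \<Longrightarrow> r p q \<noteq> 0 \<Longrightarrow> r q s \<noteq> 0 \<Longrightarrow>
      r p s = r p q * r q s"
    and r_orth: "\<And>x i j. x \<in> Y \<Longrightarrow> i < k \<Longrightarrow> j < k \<Longrightarrow> i \<noteq> j \<Longrightarrow> r (x, i) (x, j) = 0"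
  shows "\<exists>R\<subseteq>Y. card Y \<le> 2 ^ k * card R \<and>
           (\<forall>x\<in>R. \<forall>y\<in>R. \<forall>i<k. \<forall>j<k. r (x, i) (y, j) \<noteq> - 1)"
proof -
  have "finite J" using Y by (simp add: J_def)
  have "\<exists>V\<subseteq>J. (\<forall>p\<in>V. \<forall>q\<in>V. p \<noteq> q \<longrightarrow> \<not> r p q \<noteq> 0) \<and> (\<forall>q\<in>J - V. \<exists>p\<in>V. r p q \<noteq> 0)"
  proof (rule ex_dominating_independent[OF \<open>finite J\<close>])
    show "r q p \<noteq> 0" if "p \<in> J" "q \<in> J" "r p q \<noteq> 0" for p q
      using that r_sym[of p q] by simp
  qed
  then obtain V where V: "V \<subseteq> J" and V_indep: "\<forall>p\<in>V. \<forall>q\<in>V. p \<noteq> q \<longrightarrow> \<not> r p q \<noteq> 0"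
    and V_dom: "\<forall>q\<in>J - V. \<exists>p\<in>V. r p q \<noteq> 0"
    by (elim exE conjE) (rule that)
  have indep: "r p q = 0" if "p \<in> V" "q \<in> V" "p \<noteq> q" for p q
    using V_indep that by blast
  have dom: "\<exists>p\<in>V. r p q \<noteq> 0" if "q \<in> J - V" for q
    using V_dom that by blast
  have finV: "finite V" using V \<open>finite J\<close> finite_subset by blast
  have "\<exists>p\<in>V. r p q \<noteq> 0" if "q \<in> J" for q
    using that dom[of q] r_refl[of q] by (cases "q \<in> V") force+
  then obtain a where a: "\<And>q. q \<in> J \<Longrightarrow> a q \<in> V" "\<And>q. q \<in> J \<Longrightarrow> r (a q) q \<noteq> 0"
    by metis
  have aJ: "a q \<in> J" if "q \<in> J" for q using a(1)[OF that] V by blast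
  define Pos where "Pos x = {a (x, i) | i. i < k \<and> r (a (x, i)) (x, i) = 1}" for x
  define Neg where "Neg x = {a (x, i) | i. i < k \<and> r (a (x, i)) (x, i) = - 1}" for x
  have J: "(x, i) \<in> J" if "x \<in> Y" "i < k" for x i using that by (simp add: J_def)
  have disj: "Pos x \<inter> Neg x = {}" if x: "x \<in> Y" for x
  proof (rule ccontr)
    assume "Pos x \<inter> Neg x \<noteq> {}"
    then obtain i j where ij: "i < k" "j < k" "a (x, i) = a (x, j)"
      "r (a (x, i)) (x, i) = 1" "r (a (x, j)) (x, j) = - 1"
      unfolding Pos_def Neg_def by blast
    hence "i \<noteq> j" by auto
    have "r (x, i) (a (x, i)) = 1" using r_sym[OF J[OF x ij(1)] aJ[OF J[OF x ij(1)]]] ij(4) by simp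
    hence "r (x, i) (x, j) = 1 * - 1"
      using r_trans[OF J[OF x ij(1)] aJ[OF J[OF x ij(1)]] J[OF x ij(2)]] ij by simp
    thus False using r_orth[OF x ij(1,2) \<open>i \<noteq> j\<close>] by simp
  qed
  have patterns: "2 ^ card V \<le> 2 ^ k * card {P\<in>Pow V. Pos x \<subseteq> P \<and> Neg x \<inter> P = {}}"
    if x: "x \<in> Y" for x
  proof (rule card_sign_patterns[OF finV _ _ disj[OF x]])
    show "Pos x \<subseteq> V" "Neg x \<subseteq> V" using a(1) J[OF x] by (auto simp: Pos_def Neg_def)
    have "Pos x \<union> Neg x \<subseteq> (\<lambda>i. a (x, i)) ` {..<k}" by (auto simp: Pos_def Neg_def)
    from card_mono[OF _ this] card_image_le[of "{..<k}" "\<lambda>i. a (x, i)"]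
    show "card (Pos x \<union> Neg x) \<le> k" by simp
  qed
  define R where "R P = {x\<in>Y. Pos x \<subseteq> P \<and> Neg x \<inter> P = {}}" for P
  have "\<exists>P\<in>Pow V. card Y \<le> 2 ^ k * card (R P)"
  proof (rule ccontr)
    assume "\<not> ?thesis"
    hence "(\<Sum>P\<in>Pow V. 2 ^ k * card (R P)) < (\<Sum>P\<in>Pow V. card Y)"
      using finV by (intro sum_strict_mono) (auto simp: not_le)
    also have "\<dots> = (\<Sum>x\<in>Y. 2 ^ card V)" using finV by (simp add: card_Pow)
    also have "\<dots> \<le> (\<Sum>x\<in>Y. 2 ^ k * card {P\<in>Pow V. Pos x \<subseteq> P \<and> Neg x \<inter> P = {}})"
      by (rule sum_mono) (rule patterns)
    also have "\<dots> = (\<Sum>P\<in>Pow V. 2 ^ k * card (R P))"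
    proof -
      have "(\<Sum>x\<in>Y. card {P\<in>Pow V. Pos x \<subseteq> P \<and> Neg x \<inter> P = {}})
          = (\<Sum>x\<in>Y. \<Sum>P\<in>Pow V. if Pos x \<subseteq> P \<and> Neg x \<inter> P = {} then 1 else 0)"
        using finV by (intro sum.cong refl) (simp add: sum.If_cases Int_def)
      also have "\<dots> = (\<Sum>P\<in>Pow V. \<Sum>x\<in>Y. if Pos x \<subseteq> P \<and> Neg x \<inter> P = {} then 1 else 0)"
        by (rule sum.swap)
      also have "\<dots> = (\<Sum>P\<in>Pow V. card (R P))"
        using Y by (intro sum.cong refl) (simp add: sum.If_cases R_def Int_def)
      finally show ?thesis by (simp flip: sum_distrib_left)
    qed
    finally show False by simp
  qed
  then obtain P where P: "card Y \<le> 2 ^ k * card (R P)" by blast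
  have "r (x, i) (y, j) \<noteq> - 1" if x: "x \<in> R P" "i < k" and y: "y \<in> R P" "j < k" for x y i j
  proof
    assume neg: "r (x, i) (y, j) = - 1"
    have xi: "(x, i) \<in> J" and yj: "(y, j) \<in> J" using x y J by (auto simp: R_def)
    have "r (a (x, i)) (y, j) = r (a (x, i)) (x, i) * r (x, i) (y, j)"
      using r_trans[OF aJ[OF xi] xi yj a(2)[OF xi]] neg by simp
    hence opp: "r (a (x, i)) (y, j) = - r (a (x, i)) (x, i)" using neg by simp
    have "r (y, j) (a (y, j)) \<noteq> 0" using a(2)[OF yj] r_sym[OF yj aJ[OF yj]] by simp
    moreover have "r (a (x, i)) (y, j) \<noteq> 0" using opp a(2)[OF xi] by simp
    ultimately have "r (a (x, i)) (a (y, j)) \<noteq> 0"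
      using r_trans[OF aJ[OF xi] yj aJ[OF yj]] by simp
    hence eq: "a (x, i) = a (y, j)" using indep[OF a(1)[OF xi] a(1)[OF yj]] by blast
    have "r (a (x, i)) (x, i) = 1 \<or> r (a (x, i)) (x, i) = - 1"
      using r_vals[OF aJ[OF xi] xi] a(2)[OF xi] by auto
    thus False
    proof
      assume *: "r (a (x, i)) (x, i) = 1"
      hence "a (x, i) \<in> Pos x" unfolding Pos_def using x(2) by blast
      moreover have "r (a (y, j)) (y, j) = - 1" using opp eq * by simp
      hence "a (x, i) \<in> Neg y" unfolding Neg_def eq using y(2) by blast
      ultimately have "a (x, i) \<in> Pos x" "a (x, i) \<in> Neg y" by blast+
      thus False using x(1) y(1) by (auto simp: R_def)
    next
      assume *: "r (a (x, i)) (x, i) = - 1"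
      hence "a (x, i) \<in> Neg x" unfolding Neg_def using x(2) by blast
      moreover have "r (a (y, j)) (y, j) = 1" using opp eq * by simp
      hence "a (x, i) \<in> Pos y" unfolding Pos_def eq using y(2) by blast
      ultimately have "a (x, i) \<in> Neg x" "a (x, i) \<in> Pos y" by blast+
      thus False using x(1) y(1) by (auto simp: R_def)
    qed
  qed
  moreover have "R P \<subseteq> Y" by (auto simp: R_def)
  ultimately show ?thesis using P by blast
qed

text \<open>Nearly parallel unit vectors are close in norm up to the sign, so the triangle inequality makes
  near-parallelism transitive.\<close>

lemma near_unit_sign_mult:
  fixes s t z :: int
  assumes norm: "\<bar>ip n a a - 1\<bar> \<le> \<eta>" "\<bar>ip n b b - 1\<bar> \<le> \<eta>" "\<bar>ip n c c - 1\<bar> \<le> \<eta>"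
    and ab: "\<bar>ip n a b - s\<bar> \<le> \<eta>" and bc: "\<bar>ip n b c - t\<bar> \<le> \<eta>" and ac: "\<bar>ip n a c - z\<bar> \<le> \<eta>"
    and \<eta>: "\<eta> \<le> 1 / 100" and s: "s \<in> {-1, 1}" and t: "t \<in> {-1, 1}" and z: "z \<in> {-1, 0, 1}"
  shows "z = s * t"
proof -
  define p where "p i = s * a i - b i" for i
  define q where "q i = t * c i - b i" for i
  have pdef: "p = (\<lambda>i. real_of_int s * a i - b i)" and qdef: "q = (\<lambda>i. real_of_int t * c i - b i)"
    by (auto simp: p_def q_def)
  have s2: "real_of_int s * real_of_int s = 1" "real_of_int t * real_of_int t = 1"
    using s t by auto
  have pp: "ip n p p = ip n a a + ip n b b - 2 * (s * ip n a b)"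
    using s by (auto simp: pdef ip_diff_left ip_diff_right ip_scale_left ip_scale_right ip_commute[of n b a])
  have qq: "ip n q q = ip n c c + ip n b b - 2 * (t * ip n b c)"
    using t by (auto simp: qdef ip_diff_left ip_diff_right ip_scale_left ip_scale_right ip_commute[of n c b])
  have pq: "ip n p q = s * (t * ip n a c) - s * ip n a b - t * ip n b c + ip n b b"
    by (simp add: pdef qdef ip_diff_left ip_diff_right ip_scale_left ip_scale_right algebra_simps)
  have "0 \<le> ip n (\<lambda>i. p i + q i) (\<lambda>i. p i + q i)" by (rule ip_self_nonneg)
  hence ge: "- (2 * ip n p q) \<le> ip n p p + ip n q q"
    by (simp add: ip_add_left ip_add_right ip_commute[of n q p])
  have "1 - \<eta> \<le> s * ip n a b" "1 - \<eta> \<le> t * ip n b c" using ab bc s t by (auto simp: abs_le_iff)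
  moreover have "ip n a a \<le> 1 + \<eta>" "ip n b b \<le> 1 + \<eta>" "ip n c c \<le> 1 + \<eta>"
    using norm by (simp_all add: abs_le_iff)
  ultimately have "1 / 2 < s * (t * ip n a c)"
    using ge \<eta> unfolding pp qq pq right_diff_distrib distrib_left by linarith
  thus ?thesis using s t z ac \<eta> by (auto simp: abs_le_iff)
qed

context integral_shell
begin

section \<open>Near-orthonormal decompositions of chained vectors\<close>

text \<open>The vectors \<open>v q - centre Q\<close> are nearly orthogonal, of squared norm about \<open>k - b\<close>, so by a Bessel
  inequality the squares of the inner products of \<open>w\<close> with them sum to at most \<open>k\<^sup>2\<close>. One of the
  \<open>T\<close> terms is therefore at most \<open>k\<^sup>2 / T\<close>.\<close>

lemma ex_member_near_centre:
  assumes Q: "clique b Q" "b < k" and w: "ip n w w \<le> real k"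
  shows "\<exists>q\<in>Q. \<bar>ip n w (centre Q) - ip n w (v q)\<bar> \<le> 1 / (800 * (real k)\<^sup>2)"
proof -
  define d where "d q = ip n w (v q) - ip n w (centre Q)" for q
  define S where "S = (\<Sum>q\<in>Q. (d q)\<^sup>2)"
  define \<delta> where "\<delta> = (real k - real b) / real T"
  define u where "u q i = v q i - centre Q i" for q i
  have udef: "u q = (\<lambda>i. v q i - centre Q i)" for q by (simp add: u_def fun_eq_iff)
  define z where "z = (\<lambda>i. \<Sum>q\<in>Q. d q * u q i)"
  have fin: "finite Q" and QX: "\<And>q. q \<in> Q \<Longrightarrow> q \<in> X" and card: "card Q = T"
    using Q(1) finite_sub by (auto simp: clique_def)
  have \<delta>0: "0 \<le> \<delta>" using Q(2) by (simp add: \<delta>_def)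
  have S0: "0 \<le> S" by (simp add: S_def sum_nonneg)
  have "ip n w z = (\<Sum>q\<in>Q. d q * d q)"
    unfolding z_def ip_sum_right ip_scale_right
    by (intro sum.cong) (auto simp: udef ip_diff_right d_def)
  hence wz: "ip n w z = S" by (simp add: S_def power2_eq_square)
  have uu: "ip n (u p) (u q) = (if p = q then real k - real b else 0) - \<delta>" if "p \<in> Q" "q \<in> Q" for p q
  proof -
    have "ip n (u p) (u q) = real_of_int (g p q) - real b - \<delta>"
      using ip_centre_member[OF Q(1)] ip_centre_self[OF Q(1)] that QX
      by (simp add: udef ip_diff_left ip_diff_right g_ip ip_commute[of n "v p" "centre Q"] \<delta>_def)
    thus ?thesis using Q(1) that g_self[OF QX[OF that(1)]] by (auto simp: clique_def)
  qed
  define D where "D = (\<Sum>q\<in>Q. d q)"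
  have "ip n z z = (\<Sum>p\<in>Q. \<Sum>q\<in>Q. d p * d q * ((if p = q then real k - real b else 0) - \<delta>))"
    unfolding z_def ip_comb by (intro sum.cong refl) (simp add: uu)
  also have "\<dots> = (\<Sum>p\<in>Q. (real k - real b) * (d p)\<^sup>2 - \<delta> * (d p * D))"
  proof (rule sum.cong)
    fix p assume p: "p \<in> Q"
    have "(\<Sum>q\<in>Q. d p * d q * ((if p = q then real k - real b else 0) - \<delta>))
        = (\<Sum>q\<in>Q. (if p = q then d p * d p * (real k - real b) else 0) - \<delta> * (d p * d q))"
      by (intro sum.cong) (auto simp: algebra_simps)
    also have "\<dots> = d p * d p * (real k - real b) - \<delta> * (d p * D)"
      using fin p by (simp add: sum_subtractf D_def sum_distrib_left)
    finally show "(\<Sum>q\<in>Q. d p * d q * ((if p = q then real k - real b else 0) - \<delta>))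
        = (real k - real b) * (d p)\<^sup>2 - \<delta> * (d p * D)"
      by (simp add: power2_eq_square)
  qed simp
  also have "\<dots> = (real k - real b) * S - \<delta> * D\<^sup>2"
  proof -
    have "(\<Sum>p\<in>Q. \<delta> * (d p * D)) = \<delta> * ((\<Sum>p\<in>Q. d p) * D)"
      by (simp only: sum_distrib_left sum_distrib_right)
    hence "(\<Sum>p\<in>Q. \<delta> * (d p * D)) = \<delta> * D\<^sup>2"
      by (simp only: D_def power2_eq_square)
    moreover have "(\<Sum>p\<in>Q. (real k - real b) * (d p)\<^sup>2) = (real k - real b) * S"
      by (simp only: S_def sum_distrib_left)
    ultimately show ?thesis by (simp only: sum_subtractf)
  qed
  also have "\<dots> \<le> real k * S"
  proof -
    have "0 \<le> \<delta> * D\<^sup>2" "0 \<le> real b * S" using \<delta>0 S0 by auto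
    thus ?thesis by (simp add: algebra_simps)
  qed
  finally have zz: "ip n z z \<le> real k * S" .
  have "S * S \<le> ip n w w * ip n z z" using ip_Cauchy_Schwarz[of n w z] wz by (simp add: power2_eq_square)
  also have "\<dots> \<le> real k * (real k * S)"
    using w zz ip_self_nonneg by (intro mult_mono) auto
  finally have "S * S \<le> (real k)\<^sup>2 * S" by (simp add: power2_eq_square)
  hence S_le: "S \<le> (real k)\<^sup>2" using S0 by (cases "S = 0") auto
  have "\<exists>q\<in>Q. (d q)\<^sup>2 \<le> (real k)\<^sup>2 / real T"
  proof (rule ccontr)
    assume "\<not> ?thesis"
    hence "(\<Sum>q\<in>Q. (real k)\<^sup>2 / real T) < S"
      unfolding S_def using fin card T_pos by (intro sum_strict_mono) (auto simp: not_le)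
    thus False using S_le card T_pos by simp
  qed
  then obtain q where q: "q \<in> Q" "(d q)\<^sup>2 \<le> (real k)\<^sup>2 / real T" by blast
  have "(real k)\<^sup>2 / real T = (1 / (800 * (real k)\<^sup>2))\<^sup>2"
    using k_pos by (simp add: clique_size_def field_simps power2_eq_square power3_eq_cube)
  hence "(d q)\<^sup>2 \<le> (1 / (800 * (real k)\<^sup>2))\<^sup>2" using q(2) by simp
  hence "\<bar>d q\<bar> \<le> 1 / (800 * (real k)\<^sup>2)"
    by (metis abs_le_square_iff abs_of_nonneg divide_nonneg_nonneg zero_le_one zero_le_mult_iff zero_le_numeral zero_le_power2)
  thus ?thesis using q(1) by (auto simp: d_def abs_minus_commute)
qed

definition chain_of :: "'a \<Rightarrow> nat \<Rightarrow> 'a set" where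
  "chain_of x = (SOME Q. chain_attached (k - 1) Q {x})"

text \<open>The Gram matrix of the levels of one vector is nearly \<open>min i j\<close>, as for the partial sums of an
  orthonormal sequence; the increments therefore are nearly orthonormal, and they sum to the
  vector. In the model case the increments are close to the unit vectors \<open>e\<^sub>i\<close>.\<close>

definition level :: "'a \<Rightarrow> nat \<Rightarrow> nat \<Rightarrow> real" where
  "level x i = (if i = 0 then (\<lambda>_. 0) else if i < k then centre (chain_of x i) else v x)"

definition increment :: "'a \<Rightarrow> nat \<Rightarrow> nat \<Rightarrow> real" where
  "increment x i l = level x (Suc i) l - level x i l"

lemma chain_of:
  assumes "chained x"
  shows "0 < i \<Longrightarrow> i < k \<Longrightarrow> clique i (chain_of x i)"
    and "0 < i \<Longrightarrow> i < j \<Longrightarrow> j < k \<Longrightarrow> attached i (chain_of x i) (chain_of x j)"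
    and "0 < i \<Longrightarrow> i < k \<Longrightarrow> attached i (chain_of x i) {x}"
proof -
  have "chain_attached (k - 1) (chain_of x) {x}"
    using assms unfolding chained_def chain_of_def by (rule someI_ex)
  thus "0 < i \<Longrightarrow> i < k \<Longrightarrow> clique i (chain_of x i)"
    and "0 < i \<Longrightarrow> i < j \<Longrightarrow> j < k \<Longrightarrow> attached i (chain_of x i) (chain_of x j)"
    and "0 < i \<Longrightarrow> i < k \<Longrightarrow> attached i (chain_of x i) {x}"
    by (auto simp: chain_attached_def chain_def)
qed

lemma ip_level_less:
  assumes x: "x \<in> X" "chained x" and ij: "i < j" "j \<le> k"
  shows "ip n (level x i) (level x j) = real i"
proof (cases "i = 0")
  case True
  thus ?thesis by (simp add: level_def ip_zero_left)
next
  case False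
  hence Q: "clique i (chain_of x i)" using chain_of(1)[OF x(2)] ij by simp
  show ?thesis
  proof (cases "j = k")
    case True
    have "ip n (centre (chain_of x i)) (v x) = real i"
      by (rule ip_centre_attached[OF Q chain_of(3)[OF x(2)], where y = x]) (use False ij x in auto)
    thus ?thesis using False ij True by (simp add: level_def)
  next
    case j: False
    hence P: "clique j (chain_of x j)" using chain_of(1)[OF x(2)] ij by simp
    hence "ip n (centre (chain_of x i)) (v q) = real i" if "q \<in> chain_of x j" for q
      using ip_centre_attached[OF Q chain_of(2)[OF x(2), of i j] that] False ij j
      by (simp add: clique_def)
    hence "ip n (centre (chain_of x i)) (centre (chain_of x j)) = real i"
      using P T_pos by (simp add: ip_centre_right clique_def)
    thus ?thesis using False ij j by (simp add: level_def)
  qed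
qed

lemma ip_level_self:
  assumes x: "x \<in> X" "chained x" and i: "i \<le> k"
  shows "real i \<le> ip n (level x i) (level x i)"
    "ip n (level x i) (level x i) \<le> real i + 1 / (800 * (real k)\<^sup>2)"
    "ip n (level x i) (level x i) \<le> real k"
proof -
  have k1: "1 \<le> real k" using k_pos by simp
  have T1: "1 \<le> real T" using T_pos by simp
  have bound: "real k / real T \<le> 1 / (800 * (real k)\<^sup>2)"
  proof -
    have "real T = 640000 * real k ^ 6"
      by (simp add: clique_size_def power_mult_distrib flip: power_mult)
    moreover have "800 * (real k * (real k)\<^sup>2) \<le> 640000 * real k ^ 6"
    proof -
      have "real k ^ 3 \<le> real k ^ 6" using k1 by (intro power_increasing) auto
      moreover have "0 \<le> real k ^ 6" by simp
      moreover have "real k * (real k)\<^sup>2 = real k ^ 3" by (simp add: power3_eq_cube power2_eq_square)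
      ultimately show ?thesis by linarith
    qed
    ultimately show ?thesis using k1 by (simp add: divide_simps mult.commute mult.left_commute)
  qed
  consider "i = 0" | "0 < i" "i < k" | "0 < i" "i = k" using i by linarith
  hence "real i \<le> ip n (level x i) (level x i) \<and>
    ip n (level x i) (level x i) \<le> real i + 1 / (800 * (real k)\<^sup>2) \<and>
    ip n (level x i) (level x i) \<le> real k"
  proof cases
    case 1
    thus ?thesis by (simp add: level_def ip_zero_left)
  next
    case 2
    have eq: "ip n (level x i) (level x i) = real i + (real k - real i) / real T"
      using ip_centre_self[OF chain_of(1)[OF x(2) 2]] 2 by (simp add: level_def)
    have "(real k - real i) / real T \<le> real k / real T" by (intro divide_right_mono) auto
    moreover have "(real k - real i) / real T \<le> real k - real i"
      using divide_left_mono[of 1 "real T" "real k - real i"] T1 2 by simp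
    moreover have "0 \<le> (real k - real i) / real T" using 2 by simp
    ultimately show ?thesis using bound unfolding eq by (intro conjI) linarith+
  next
    case 3
    thus ?thesis using g_self[OF x(1)] by (simp add: level_def flip: g_ip[OF x(1) x(1)])
  qed
  thus "real i \<le> ip n (level x i) (level x i)"
    "ip n (level x i) (level x i) \<le> real i + 1 / (800 * (real k)\<^sup>2)"
    "ip n (level x i) (level x i) \<le> real k" by auto
qed

lemma ip_level_near_min:
  assumes x: "x \<in> X" "chained x" and ij: "i \<le> k" "j \<le> k"
  shows "\<bar>ip n (level x i) (level x j) - real (min i j)\<bar> \<le> 1 / (800 * (real k)\<^sup>2)"
proof -
  consider "i < j" | "j < i" | "i = j" by linarith
  thus ?thesis
  proof cases
    case 1
    thus ?thesis using ip_level_less[OF x 1 ij(2)] by simp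
  next
    case 2
    thus ?thesis using ip_level_less[OF x 2 ij(1)] by (simp add: ip_commute)
  next
    case 3
    thus ?thesis using ip_level_self[OF x ij(1)] by (simp add: abs_le_iff)
  qed
qed

lemma ex_point_near_level:
  assumes x: "x \<in> X" "chained x" and i: "i \<le> k" and w: "ip n w w \<le> real k"
  shows "\<exists>p\<in>insert (\<lambda>_. 0) (v ` X). \<bar>ip n w (level x i) - ip n w p\<bar> \<le> 1 / (800 * (real k)\<^sup>2)"
proof -
  consider "i = 0" | "0 < i" "i < k" | "0 < i" "i = k" using i by linarith
  thus ?thesis
  proof cases
    case 1
    thus ?thesis by (simp add: level_def)
  next
    case 2
    have Q: "clique i (chain_of x i)" by (rule chain_of(1)[OF x(2) 2])
    from ex_member_near_centre[OF Q 2(2) w] show ?thesis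
      using Q 2 by (force simp: level_def clique_def)
  next
    case 3
    thus ?thesis using x(1) by (intro bexI[of _ "v x"]) (auto simp: level_def)
  qed
qed

text \<open>Both levels are replaced by members of the shell, one after the other, and the inner product
  of two members is an integer.\<close>

lemma ip_level_near_int:
  assumes x: "x \<in> X" "chained x" and y: "y \<in> X" "chained y" and ij: "i \<le> k" "j \<le> k"
  shows "\<exists>z::int. \<bar>ip n (level x i) (level y j) - z\<bar> \<le> 2 / (800 * (real k)\<^sup>2)"
proof -
  obtain p where p: "p \<in> insert (\<lambda>_. 0) (v ` X)"
    "\<bar>ip n (level x i) (level y j) - ip n (level x i) p\<bar> \<le> 1 / (800 * (real k)\<^sup>2)"
    using ex_point_near_level[OF y ij(2) ip_level_self(3)[OF x ij(1)]] by blast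
  have "ip n p p \<le> real k"
    using p(1) g_self by (auto simp: ip_zero_left simp flip: g_ip)
  then obtain q where q: "q \<in> insert (\<lambda>_. 0) (v ` X)"
    "\<bar>ip n p (level x i) - ip n p q\<bar> \<le> 1 / (800 * (real k)\<^sup>2)"
    using ex_point_near_level[OF x ij(1)] by blast
  have "\<exists>z::int. ip n p q = z"
    using p(1) q(1) by (auto simp: ip_zero_left ip_zero_right simp flip: g_ip intro: exI[of _ 0])
  then obtain z :: int where "ip n p q = z" by blast
  hence "\<bar>ip n (level x i) (level y j) - z\<bar> \<le> 1 / (800 * (real k)\<^sup>2) + 1 / (800 * (real k)\<^sup>2)"
    using p(2) q(2) by (simp add: ip_commute[of n p "level x i"] abs_le_iff)
  thus ?thesis by (auto simp: add_divide_distrib[symmetric])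
qed

lemma ip_increment:
  "ip n (increment x i) (increment y j) = ip n (level x (Suc i)) (level y (Suc j))
     - ip n (level x (Suc i)) (level y j) - ip n (level x i) (level y (Suc j)) + ip n (level x i) (level y j)"
proof -
  have "increment x i = (\<lambda>l. level x (Suc i) l - level x i l)" for x i
    by (simp add: increment_def fun_eq_iff)
  thus ?thesis by (simp add: ip_diff_left ip_diff_right)
qed

lemma increments_near_orthonormal:
  assumes x: "x \<in> X" "chained x" and ij: "i < k" "j < k"
  shows "\<bar>ip n (increment x i) (increment x j) - (if i = j then 1 else 0)\<bar> \<le> 1 / (100 * (real k)\<^sup>2)"
proof -
  define e where "e = 1 / (800 * (real k)\<^sup>2)"
  have "0 \<le> e" by (simp add: e_def)
  define M where "M i j = real (min i j)" for i j
  note l = ip_level_near_min[OF x, folded e_def M_def, unfolded abs_le_iff]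
  have "\<bar>ip n (increment x i) (increment x j) - (M (Suc i) (Suc j) - M (Suc i) j - M i (Suc j) + M i j)\<bar>
      \<le> 4 * e"
    using l[of "Suc i" "Suc j"] l[of "Suc i" j] l[of i "Suc j"] l[of i j] ij
    unfolding ip_increment abs_le_iff by simp
  moreover have "M (Suc i) (Suc j) - M (Suc i) j - M i (Suc j) + M i j = (if i = j then 1 else 0)"
    by (auto simp: M_def min_def)
  ultimately have "\<bar>ip n (increment x i) (increment x j) - (if i = j then 1 else 0)\<bar> \<le> 4 * e"
    by simp
  thus ?thesis using \<open>0 \<le> e\<close> by (simp add: e_def)
qed

lemma ip_increment_near_int:
  assumes x: "x \<in> X" "chained x" and y: "y \<in> X" "chained y" and ij: "i < k" "j < k"
  shows "\<exists>z::int. \<bar>ip n (increment x i) (increment y j) - z\<bar> \<le> 1 / (100 * (real k)\<^sup>2)"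
proof -
  define e where "e = 2 / (800 * (real k)\<^sup>2)"
  note l = ip_level_near_int[OF x y, folded e_def]
  obtain z1 :: int where z1: "\<bar>ip n (level x (Suc i)) (level y (Suc j)) - z1\<bar> \<le> e"
    using l[of "Suc i" "Suc j"] ij by auto
  obtain z2 :: int where z2: "\<bar>ip n (level x (Suc i)) (level y j) - z2\<bar> \<le> e"
    using l[of "Suc i" j] ij by auto
  obtain z3 :: int where z3: "\<bar>ip n (level x i) (level y (Suc j)) - z3\<bar> \<le> e"
    using l[of i "Suc j"] ij by auto
  obtain z4 :: int where z4: "\<bar>ip n (level x i) (level y j) - z4\<bar> \<le> e"
    using l[of i j] ij by auto
  have "\<bar>ip n (increment x i) (increment y j) - real_of_int (z1 - z2 - z3 + z4)\<bar> \<le> 4 * e"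
    using z1 z2 z3 z4 unfolding ip_increment abs_le_iff by simp
  moreover have "4 * e = 1 / (100 * (real k)\<^sup>2)" by (simp add: e_def)
  ultimately show ?thesis by metis
qed

lemma sum_increments: "(\<Sum>i<k. increment x i l) = v x l"
  using sum_lessThan_telescope[of "\<lambda>i. level x i l" k] k_pos by (simp add: increment_def level_def)

definition rounded_ip :: "'a \<times> nat \<Rightarrow> 'a \<times> nat \<Rightarrow> int" where
  "rounded_ip p q = round (ip n (increment (fst p) (snd p)) (increment (fst q) (snd q)))"

lemma rounded_ip_near:
  assumes x: "x \<in> X" "chained x" and y: "y \<in> X" "chained y" and ij: "i < k" "j < k"
  shows "\<bar>ip n (increment x i) (increment y j) - rounded_ip (x, i) (y, j)\<bar> \<le> 1 / (100 * (real k)\<^sup>2)"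
proof -
  obtain z :: int where z: "\<bar>ip n (increment x i) (increment y j) - z\<bar> \<le> 1 / (100 * (real k)\<^sup>2)"
    using ip_increment_near_int[OF x y ij] by blast
  have "1 \<le> (real k)\<^sup>2" using k_pos by simp
  hence "1 / (100 * (real k)\<^sup>2) < 1 / 2" by (simp add: divide_simps)
  hence "round (ip n (increment x i) (increment y j)) = z"
    using z by (intro round_unique') linarith
  thus ?thesis using z by (simp add: rounded_ip_def)
qed

text \<open>If \<open>g x y < 0\<close>, then an increment of \<open>x\<close> is nearly opposite to an increment of \<open>y\<close>, because
  \<open>g x y\<close> is the sum of all the inner products of increments and these are nearly integers in
  \<open>{-1, 0, 1}\<close>. A choice of signs thus leaves a fraction of at least \<open>2 ^ (- k)\<close> of the chained
  vectors without negative inner products.\<close>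

lemma card_chained_le: "card {x\<in>X. chained x} \<le> 2 ^ k * ((n + k) choose k)"
proof -
  define Y where "Y = {x\<in>X. chained x}"
  define \<eta> where "\<eta> = 1 / (100 * (real k)\<^sup>2)"
  have k2: "1 \<le> (real k)\<^sup>2" using k_pos by simp
  hence \<eta>: "\<eta> \<le> 1 / 100" "0 \<le> \<eta>" by (simp_all add: \<eta>_def divide_simps)
  have Y: "x \<in> X" "chained x" if "x \<in> Y" for x using that by (auto simp: Y_def)
  have near: "\<bar>ip n (increment x i) (increment y j) - rounded_ip (x, i) (y, j)\<bar> \<le> \<eta>"
    if "x \<in> Y" "y \<in> Y" "i < k" "j < k" for x y i j
    using rounded_ip_near[OF Y Y] that by (simp add: \<eta>_def)
  have on: "\<bar>ip n (increment x i) (increment x j) - (if i = j then 1 else 0)\<bar> \<le> \<eta>"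
    if "x \<in> Y" "i < k" "j < k" for x i j
    using increments_near_orthonormal[OF Y] that by (simp add: \<eta>_def)
  have norm: "\<bar>ip n (increment x i) (increment x i) - 1\<bar> \<le> \<eta>" if "x \<in> Y" "i < k" for x i
    using on[OF that(1) that(2) that(2)] by simp
  have vals: "rounded_ip (x, i) (y, j) \<in> {-1, 0, 1}" if "x \<in> Y" "y \<in> Y" "i < k" "j < k" for x y i j
  proof -
    have "(ip n (increment x i) (increment y j))\<^sup>2 \<le>
        ip n (increment x i) (increment x i) * ip n (increment y j) (increment y j)"
      by (rule ip_Cauchy_Schwarz)
    also have "\<dots> \<le> (1 + \<eta>) * (1 + \<eta>)"
      using norm that ip_self_nonneg \<eta> by (intro mult_mono) (auto simp: abs_le_iff algebra_simps)
    finally have "\<bar>ip n (increment x i) (increment y j)\<bar> \<le> 1 + \<eta>"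
      using \<eta>(2) by (metis abs_le_square_iff abs_of_nonneg add_nonneg_nonneg power2_eq_square zero_le_one)
    hence "\<bar>real_of_int (rounded_ip (x, i) (y, j))\<bar> < 2"
      using near[OF that] \<eta> by linarith
    hence "\<bar>rounded_ip (x, i) (y, j)\<bar> < 2" by linarith
    thus ?thesis by auto
  qed
  have int_eq: "a = b" if "\<bar>real_of_int a - real_of_int b\<bar> < 1" for a b :: int using that by linarith
  have "\<exists>R\<subseteq>Y. card Y \<le> 2 ^ k * card R \<and> (\<forall>x\<in>R. \<forall>y\<in>R. \<forall>i<k. \<forall>j<k. rounded_ip (x, i) (y, j) \<noteq> - 1)"
  proof (rule ex_sign_consistent_subset)
    show "finite Y" using finite_X by (simp add: Y_def)
    show "rounded_ip p q \<in> {-1, 0, 1}" if "p \<in> Y \<times> {..<k}" "q \<in> Y \<times> {..<k}" for p q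
      using that vals by (cases p; cases q) auto
    show "rounded_ip p q = rounded_ip q p" for p q by (simp add: rounded_ip_def ip_commute)
    show "rounded_ip p p = 1" if "p \<in> Y \<times> {..<k}" for p
    proof -
      obtain x i where p: "p = (x, i)" "x \<in> Y" "i < k" using \<open>p \<in> Y \<times> {..<k}\<close> by auto
      show ?thesis
        by (rule int_eq) (use near[OF p(2,2,3,3)] norm[OF p(2,3)] \<eta> in \<open>simp add: p(1) abs_le_iff abs_less_iff; linarith\<close>)
    qed
    show "rounded_ip (x, i) (x, j) = 0" if "x \<in> Y" "i < k" "j < k" "i \<noteq> j" for x i j
      by (rule int_eq) (use near[of x x i j] on[of x i j] \<eta> that in \<open>simp add: abs_le_iff abs_less_iff; linarith\<close>)
    show "rounded_ip p s = rounded_ip p q * rounded_ip q s"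
      if "p \<in> Y \<times> {..<k}" "q \<in> Y \<times> {..<k}" "s \<in> Y \<times> {..<k}" "rounded_ip p q \<noteq> 0" "rounded_ip q s \<noteq> 0" for p q s
    proof -
      obtain x i where p: "p = (x, i)" "x \<in> Y" "i < k" using \<open>p \<in> Y \<times> {..<k}\<close> by auto
      obtain y j where q: "q = (y, j)" "y \<in> Y" "j < k" using \<open>q \<in> Y \<times> {..<k}\<close> by auto
      obtain z l where r: "s = (z, l)" "z \<in> Y" "l < k" using \<open>s \<in> Y \<times> {..<k}\<close> by auto
      note eq = p(1) q(1) r(1) and mem = p(2,3) q(2,3) r(2,3)
      show ?thesis unfolding eq
      proof (rule near_unit_sign_mult[OF norm norm norm near near near \<eta>(1)])
        show "rounded_ip (x, i) (y, j) \<in> {-1, 1}" "rounded_ip (y, j) (z, l) \<in> {-1, 1}"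
          using vals[of x y i j] vals[of y z j l] that mem eq by auto
        show "rounded_ip (x, i) (z, l) \<in> {-1, 0, 1}" using vals mem by blast
      qed (use mem in auto)
    qed
  qed
  then obtain R where R: "R \<subseteq> Y" "card Y \<le> 2 ^ k * card R"
    and sgn: "\<And>x y i j. x \<in> R \<Longrightarrow> y \<in> R \<Longrightarrow> i < k \<Longrightarrow> j < k \<Longrightarrow> rounded_ip (x, i) (y, j) \<noteq> - 1"
    by blast
  have "0 \<le> g x y" if xy: "x \<in> R" "y \<in> R" for x y
  proof -
    have xyY: "x \<in> Y" "y \<in> Y" using xy R by auto
    have "v x = (\<lambda>l. \<Sum>i<k. increment x i l)" for x by (simp add: sum_increments)
    hence "real_of_int (g x y) = (\<Sum>i<k. \<Sum>j<k. ip n (increment x i) (increment y j))"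
      using g_ip[OF Y(1) Y(1), OF xyY] by (simp add: ip_sum_left ip_sum_right)
    hence "real_of_int (g x y) - (\<Sum>i<k. \<Sum>j<k. real_of_int (rounded_ip (x, i) (y, j)))
        = (\<Sum>i<k. \<Sum>j<k. ip n (increment x i) (increment y j) - rounded_ip (x, i) (y, j))"
      by (simp add: sum_subtractf)
    also have "- (real k * (real k * \<eta>)) \<le> \<dots>"
    proof -
      have "(\<Sum>i<k. \<Sum>j<k. - \<eta>) \<le>
          (\<Sum>i<k. \<Sum>j<k. ip n (increment x i) (increment y j) - rounded_ip (x, i) (y, j))"
      proof (intro sum_mono)
        fix i j assume "i \<in> {..<k}" "j \<in> {..<k}"
        thus "- \<eta> \<le> ip n (increment x i) (increment y j) - rounded_ip (x, i) (y, j)"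
          using near[OF xyY, of i j] by (simp add: abs_le_iff)
      qed
      thus ?thesis by simp
    qed
    finally have "(\<Sum>i<k. \<Sum>j<k. real_of_int (rounded_ip (x, i) (y, j))) - 1 / 100 \<le> real_of_int (g x y)"
      using k2 k_pos by (simp add: \<eta>_def power2_eq_square)
    moreover have "0 \<le> (\<Sum>i<k. \<Sum>j<k. real_of_int (rounded_ip (x, i) (y, j)))"
    proof (intro sum_nonneg)
      fix i j assume "i \<in> {..<k}" "j \<in> {..<k}"
      hence "rounded_ip (x, i) (y, j) \<in> {0, 1}" using vals[OF xyY, of i j] sgn[OF xy, of i j] by auto
      thus "0 \<le> real_of_int (rounded_ip (x, i) (y, j))" by auto
    qed
    ultimately have "- 1 < real_of_int (g x y)" by linarith
    thus ?thesis by linarith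
  qed
  moreover have "R \<subseteq> X" using R Y by blast
  ultimately have "card R \<le> (n + k) choose k" by (intro card_nonneg_products) auto
  hence "2 ^ k * card R \<le> 2 ^ k * ((n + k) choose k)" by (rule mult_left_mono) simp
  thus ?thesis using R(2) unfolding Y_def by linarith
qed

lemma card_shell_le: "card X \<le> 2 ^ k * ((n + k) choose k) + (descent_factor k * n) ^ (k - 1)"
proof -
  have "X = {x\<in>X. chained x} \<union> {x\<in>X. \<not> chained x}" by blast
  hence "card X \<le> card {x\<in>X. chained x} + card {x\<in>X. \<not> chained x}"
    using card_Un_le[of "{x\<in>X. chained x}" "{x\<in>X. \<not> chained x}"] by argo
  moreover have "card {x\<in>X. \<not> chained x} \<le> (descent_factor k * n) ^ (k - 1)"
    by (rule card_all_unchained_le) auto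
  ultimately show ?thesis using card_chained_le by linarith
qed

end

section \<open>Counting in integral lattices\<close>

lemma is_lattice_subset_carrier:
  assumes "is_lattice n L"
  shows "L \<subseteq> carrier_vec n"
proof -
  interpret vec_module "TYPE(real)" n .
  obtain B where B: "finite B" "B \<subseteq> carrier_vec n"
    "L = {real_lincomb n (\<lambda>b. real_of_int (c b)) B | c. True}"
    using assms by (auto simp: is_lattice_def)
  thus ?thesis by (auto intro!: lincomb_closed)
qed

lemma euclidean_norm_square: "(euclidean_norm y)\<^sup>2 = scalar_prod y y"
  by (simp add: euclidean_norm_def scalar_prod_def sum_nonneg)

lemma card_integral_shell_le:
  fixes S :: "real vec set"
  assumes carr: "S \<subseteq> carrier_vec n" and fin: "finite S" and n: "n > 0" and k: "k > 0"
    and int: "\<And>x y. x \<in> S \<Longrightarrow> y \<in> S \<Longrightarrow> scalar_prod x y \<in> \<int>"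
    and norm: "\<And>x. x \<in> S \<Longrightarrow> scalar_prod x x = real k"
  shows "card S \<le> 2 ^ k * ((n + k) choose k) + (descent_factor k * n) ^ (k - 1)"
proof -
  interpret integral_shell n k S "\<lambda>x i. x $ i" "\<lambda>x y. \<lfloor>scalar_prod x y\<rfloor>"
  proof
    fix x y assume xy: "x \<in> S" "y \<in> S"
    have "scalar_prod x y = real_of_int \<lfloor>scalar_prod x y\<rfloor>" using int[OF xy] by simp
    moreover have "scalar_prod x y = ip n (\<lambda>i. x $ i) (\<lambda>i. y $ i)"
      using xy(2) carr by (auto simp: scalar_prod_def ip_def atLeast0LessThan)
    ultimately show "real_of_int \<lfloor>scalar_prod x y\<rfloor> = ip n (\<lambda>i. x $ i) (\<lambda>i. y $ i)" by simp
    assume neq: "x \<noteq> y"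
    have c: "x \<in> carrier_vec n" "y \<in> carrier_vec n" using xy carr by auto
    have "scalar_prod x y < real k"
    proof (cases "x = - y")
      case True
      hence "scalar_prod x y = - scalar_prod y y" using c by simp
      thus ?thesis using norm[OF xy(2)] k by simp
    next
      case False
      show ?thesis
        using abs_scalar_prod_less[OF c neq False norm[OF xy(1)] norm[OF xy(2)]] by simp
    qed
    thus "\<lfloor>scalar_prod x y\<rfloor> < int k" by (simp add: floor_less_iff)
  qed (use n k fin norm in auto)
  show ?thesis by (rule card_shell_le)
qed

lemma power_ratio_tendsto_0:
  assumes "j < k"
  shows "(\<lambda>n. real n ^ j / real n ^ k) \<longlonglongrightarrow> 0"
proof -
  have "(\<lambda>n. (1 / real n) ^ (k - j)) \<longlonglongrightarrow> 0 ^ (k - j)"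
    by (intro tendsto_power lim_1_over_n)
  hence "(\<lambda>n. (1 / real n) ^ (k - j)) \<longlonglongrightarrow> 0" using assms by (simp add: zero_power)
  moreover have "\<forall>\<^sub>F n in sequentially. (1 / real n) ^ (k - j) = real n ^ j / real n ^ k"
    using eventually_gt_at_top[of 0]
  proof eventually_elim
    case (elim n)
    have "real n ^ k = real n ^ j * real n ^ (k - j)" using assms by (simp flip: power_add)
    thus ?case using elim by (simp add: field_simps)
  qed
  ultimately show ?thesis by (rule Lim_transform_eventually)
qed

lemma shifted_power_ratio_tendsto_1: "(\<lambda>n. (real n + c) ^ j / real n ^ j) \<longlonglongrightarrow> 1"
proof -
  have "(\<lambda>n. (1 + c * (1 / real n)) ^ j) \<longlonglongrightarrow> (1 + c * 0) ^ j"
    by (intro tendsto_intros lim_1_over_n)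
  hence "(\<lambda>n. (1 + c * (1 / real n)) ^ j) \<longlonglongrightarrow> 1" by simp
  moreover have "\<forall>\<^sub>F n in sequentially. (1 + c * (1 / real n)) ^ j = (real n + c) ^ j / real n ^ j"
    using eventually_gt_at_top[of 0]
  proof eventually_elim
    case (elim n)
    hence "1 + c * (1 / real n) = (real n + c) / real n" by (simp add: field_simps)
    thus ?case by (simp add: power_divide)
  qed
  ultimately show ?thesis by (rule Lim_transform_eventually)
qed

text \<open>The estimate \<open>(n + j) choose j \<le> (n + j) ^ j\<close> suffices, as the leading coefficient
  \<open>2 ^ k * (k - 1)!\<close> is \<open>k! * (k - 1)!\<close> times the one that the exact binomial gives.\<close>

definition shell_bound :: "nat \<Rightarrow> nat \<Rightarrow> real" where
  "shell_bound j n = 2 ^ j * (real n + real j) ^ j + (real (descent_factor j) * real n) ^ (j - 1)"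

lemma shell_bound_ratio_tendsto:
  assumes "0 < j" "j \<le> k"
  shows "(\<lambda>n. shell_bound j n / real n ^ k) \<longlonglongrightarrow> (if j = k then 2 ^ k else 0)"
proof -
  have "(\<lambda>n. real n ^ j / real n ^ k) \<longlonglongrightarrow> (if j = k then 1 else 0)"
  proof (cases "j = k")
    case True
    have "\<forall>\<^sub>F n in sequentially. 1 = real n ^ j / real n ^ k"
      using eventually_gt_at_top[of 0] by eventually_elim (simp add: True)
    from Lim_transform_eventually[OF tendsto_const this] show ?thesis using True by simp
  qed (use power_ratio_tendsto_0[of j k] assms in auto)
  from tendsto_mult[OF tendsto_const[of "2 ^ j"] tendsto_mult[OF shifted_power_ratio_tendsto_1[of "real j" j] this]]
  have "(\<lambda>n. 2 ^ j * ((real n + real j) ^ j / real n ^ j * (real n ^ j / real n ^ k)))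
      \<longlonglongrightarrow> 2 ^ j * (1 * (if j = k then 1 else 0))" .
  moreover have "(\<lambda>n. real (descent_factor j) ^ (j - 1) * (real n ^ (j - 1) / real n ^ k))
      \<longlonglongrightarrow> real (descent_factor j) ^ (j - 1) * 0"
    using assms by (intro tendsto_mult tendsto_const power_ratio_tendsto_0) auto
  ultimately have "(\<lambda>n. 2 ^ j * ((real n + real j) ^ j / real n ^ j * (real n ^ j / real n ^ k))
      + real (descent_factor j) ^ (j - 1) * (real n ^ (j - 1) / real n ^ k))
      \<longlonglongrightarrow> 2 ^ j * (1 * (if j = k then 1 else 0)) + real (descent_factor j) ^ (j - 1) * 0"
    by (rule tendsto_add)
  moreover have "2 ^ j * (1 * (if j = k then 1 else 0)) + real (descent_factor j) ^ (j - 1) * 0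
      = (if j = k then 2 ^ k else (0::real))" by simp
  moreover have "\<forall>\<^sub>F n in sequentially.
      2 ^ j * ((real n + real j) ^ j / real n ^ j * (real n ^ j / real n ^ k))
        + real (descent_factor j) ^ (j - 1) * (real n ^ (j - 1) / real n ^ k) = shell_bound j n / real n ^ k"
    using eventually_gt_at_top[of 0]
    by eventually_elim (simp add: shell_bound_def power_mult_distrib add_divide_distrib)
  ultimately show ?thesis using Lim_transform_eventually by fastforce
qed

lemma card_shell_le_shell_bound:
  assumes "integral_lattice n L" "n > 0" "j > 0" "finite {y\<in>L. scalar_prod y y = real j}"
  shows "real (card {y\<in>L. scalar_prod y y = real j}) \<le> shell_bound j n"
proof -
  have "card {y\<in>L. scalar_prod y y = real j} \<le> 2 ^ j * ((n + j) choose j) + (descent_factor j * n) ^ (j - 1)"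
    using assms is_lattice_subset_carrier[of n L]
    by (intro card_integral_shell_le) (auto simp: integral_lattice_def)
  also have "\<dots> \<le> 2 ^ j * (n + j) ^ j + (descent_factor j * n) ^ (j - 1)"
    by (intro add_right_mono mult_left_mono binomial_le_pow) auto
  finally have "real (card {y\<in>L. scalar_prod y y = real j})
      \<le> real (2 ^ j * (n + j) ^ j + (descent_factor j * n) ^ (j - 1))" by (simp only: of_nat_le_iff)
  thus ?thesis by (simp add: shell_bound_def)
qed

lemma N_le_shell_sum:
  assumes L: "integral_lattice n L" and n: "n > 0" and k: "k > 0"
    and fin: "finite {y\<in>L. (euclidean_norm y)\<^sup>2 \<le> real k}"
  shows "real (N_le k L) \<le> 1 + (\<Sum>j\<in>{1..k}. shell_bound j n)"
proof -
  define S where "S j = {y\<in>L. scalar_prod y y = real j}" for j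
  have carr: "L \<subseteq> carrier_vec n" using L is_lattice_subset_carrier by (auto simp: integral_lattice_def)
  have finS: "finite (S j)" if "j \<le> k" for j
    by (rule finite_subset[OF _ fin]) (use that in \<open>auto simp: S_def euclidean_norm_square\<close>)
  have "y \<in> (\<Union>j\<in>{1..k}. S j) \<union> {0\<^sub>v n}" if y: "y \<in> L" "(euclidean_norm y)\<^sup>2 \<le> real k" for y
  proof (cases "y = 0\<^sub>v n")
    case False
    have "scalar_prod y y \<in> \<int>" "scalar_prod y y > 0" "scalar_prod y y \<le> real k"
      using y L scalar_prod_self_pos[of y n] False carr
      by (auto simp: integral_lattice_def euclidean_norm_square)
    then obtain z :: int where "scalar_prod y y = real_of_int z" "0 < z" "z \<le> int k"
      by (auto elim!: Ints_cases)
    hence "y \<in> S (nat z)" "nat z \<in> {1..k}" using y by (auto simp: S_def)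
    thus ?thesis by blast
  qed auto
  hence "{y\<in>L. (euclidean_norm y)\<^sup>2 \<le> real k} \<subseteq> (\<Union>j\<in>{1..k}. S j) \<union> {0\<^sub>v n}" by blast
  hence "N_le k L \<le> card ((\<Union>j\<in>{1..k}. S j) \<union> {0\<^sub>v n})"
    unfolding N_le_def using finS by (intro card_mono) auto
  also have "\<dots> \<le> card (\<Union>j\<in>{1..k}. S j) + 1"
    using card_Un_le[of "\<Union>j\<in>{1..k}. S j" "{0\<^sub>v n}"] by simp
  also have "\<dots> \<le> (\<Sum>j\<in>{1..k}. card (S j)) + 1"
    by (intro add_right_mono card_UN_le) simp
  finally have "real (N_le k L) \<le> real ((\<Sum>j\<in>{1..k}. card (S j)) + 1)" by (simp only: of_nat_le_iff)
  also have "\<dots> = 1 + (\<Sum>j\<in>{1..k}. real (card (S j)))" by simp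
  also have "\<dots> \<le> 1 + (\<Sum>j\<in>{1..k}. shell_bound j n)"
    using card_shell_le_shell_bound[OF L n] finS
    by (intro add_left_mono sum_mono) (auto simp: S_def)
  finally show ?thesis .
qed

lemma lattice_count_bounds:
  assumes L: "integral_lattice n L" and n: "n > 0" and k: "k > 0"
  shows "finite {y\<in>L. (euclidean_norm y)\<^sup>2 \<le> real k}"
    and "N_le k L \<le> 2 * ((n + 2 * k - 1) choose (2 * k - 1)) - 1"
    and "N_eq k L \<le> 2 * ((n + 2 * k - 2) choose (2 * k - 1))"
proof -
  have carr: "L \<subseteq> carrier_vec n" and int: "\<And>x y. x \<in> L \<Longrightarrow> y \<in> L \<Longrightarrow> scalar_prod x y \<in> \<int>"
    using L is_lattice_subset_carrier by (auto simp: integral_lattice_def)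
  have "finite {y\<in>L. (euclidean_norm y)\<^sup>2 \<le> real k} \<and>
      card {y\<in>L. (euclidean_norm y)\<^sup>2 \<le> real k} \<le> 2 * ((n + 2 * k - 1) choose (2 * k - 1)) - 1"
    by (rule integral_vectors_bound) (use carr int k in \<open>auto simp: euclidean_norm_square\<close>)
  thus "finite {y\<in>L. (euclidean_norm y)\<^sup>2 \<le> real k}"
    and "N_le k L \<le> 2 * ((n + 2 * k - 1) choose (2 * k - 1)) - 1"
    by (auto simp: N_le_def)
  show "N_eq k L \<le> 2 * ((n + 2 * k - 2) choose (2 * k - 1))"
    unfolding N_eq_def
    by (rule integral_shell_bound) (use carr int n k in \<open>auto simp: euclidean_norm_square\<close>)
qed

theorem theorem1p1:
  shows "(\<forall>(n::nat) (k::nat) L. n > 0 \<longrightarrow> k > 0 \<longrightarrow> integral_lattice n L \<longrightarrow>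
            finite {y \<in> L. (euclidean_norm y)\<^sup>2 \<le> real k} \<and>
            N_le k L \<le> 2 * ((n + 2 * k - 1) choose (2 * k - 1)) - 1 \<and>
            N_eq k L \<le> 2 * ((n + 2 * k - 2) choose (2 * k - 1))) \<and>
         (\<forall>k::nat. k > 0 \<longrightarrow>
            (\<exists>f :: nat \<Rightarrow> real.
               (\<lambda>n. f n / real n ^ k) \<longlonglongrightarrow> 0 \<and>
               (\<forall>(n::nat) L. n > 0 \<longrightarrow> integral_lattice n L \<longrightarrow>
                  real (N_le k L) \<le> 2 ^ k * fact (k - 1) * real n ^ k + f n)))"
proof (intro conjI allI impI)
  fix n k :: nat and L assume "n > 0" "k > 0" "integral_lattice n L"
  thus "finite {y \<in> L. (euclidean_norm y)\<^sup>2 \<le> real k}"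
    and "N_le k L \<le> 2 * ((n + 2 * k - 1) choose (2 * k - 1)) - 1"
    and "N_eq k L \<le> 2 * ((n + 2 * k - 2) choose (2 * k - 1))"
    by (blast intro: lattice_count_bounds)+
next
  fix k :: nat assume k: "k > 0"
  define f where "f n = 1 + (\<Sum>j\<in>{1..k}. shell_bound j n) - 2 ^ k * real n ^ k" for n
  show "\<exists>f :: nat \<Rightarrow> real. (\<lambda>n. f n / real n ^ k) \<longlonglongrightarrow> 0 \<and>
      (\<forall>(n::nat) L. n > 0 \<longrightarrow> integral_lattice n L \<longrightarrow>
         real (N_le k L) \<le> 2 ^ k * fact (k - 1) * real n ^ k + f n)"
  proof (intro exI conjI allI impI)
    have "(\<lambda>n. real n ^ 0 / real n ^ k + (\<Sum>j\<in>{1..k}. shell_bound j n / real n ^ k) - 2 ^ k)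
        \<longlonglongrightarrow> 0 + (\<Sum>j\<in>{1..k}. if j = k then 2 ^ k else 0) - 2 ^ k"
      using k by (intro tendsto_diff tendsto_add tendsto_sum tendsto_const
          shell_bound_ratio_tendsto power_ratio_tendsto_0) auto
    hence "(\<lambda>n. real n ^ 0 / real n ^ k + (\<Sum>j\<in>{1..k}. shell_bound j n / real n ^ k) - 2 ^ k) \<longlonglongrightarrow> 0"
      using k by simp
    moreover have "\<forall>\<^sub>F n in sequentially.
        real n ^ 0 / real n ^ k + (\<Sum>j\<in>{1..k}. shell_bound j n / real n ^ k) - 2 ^ k = f n / real n ^ k"
      using eventually_gt_at_top[of 0]
      by eventually_elim (simp add: f_def add_divide_distrib diff_divide_distrib sum_divide_distrib)
    ultimately show "(\<lambda>n. f n / real n ^ k) \<longlonglongrightarrow> 0" by (rule Lim_transform_eventually)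
  next
    fix n :: nat and L assume n: "n > 0" and L: "integral_lattice n L"
    have "real (N_le k L) \<le> 2 ^ k * real n ^ k + f n"
      using N_le_shell_sum[OF L n k lattice_count_bounds(1)[OF L n k]] by (simp add: f_def)
    also have "2 ^ k * real n ^ k \<le> 2 ^ k * fact (k - 1) * real n ^ k"
      by (intro mult_right_mono) (simp_all add: fact_ge_1)
    finally show "real (N_le k L) \<le> 2 ^ k * fact (k - 1) * real n ^ k + f n" by simp
  qed
qed

end
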